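(* For every integer $n\geq 5$, let $G$ be the graph "$P(n,2)$ with prism", i.e. the simple graph with vertex set $V(G)=\{a_{\xi},b_{\xi},c_{\xi} : 1\leq \xi\leq n\}$ ($3n$ distinct vertices) and edge set $$E(G)=\{a_{\xi}a_{\xi+2}\}\cup\{b_{\xi}b_{\xi+1}\}\cup\{c_{\xi}c_{\xi+1}\}\cup\{a_{\xi}b_{\xi}\}\cup\{b_{\xi}c_{\xi}\},\qquad 1\leq\xi\leq n,$$ with indices taken modulo $n$. Then the metric dimension of $G$ is $\dim(G)=3$.
   Context: For a finite connected graph $G$, $d(a,b)$ denotes the shortest-path distance between vertices $a$ and $b$. A subset $U\subseteq V(G)$ is a resolving set for $G$ if for every two distinct vertices $a,b\in V(G)$ there is a vertex $u\in U$ with $d(a,u)\neq d(b,u)$. The metric dimension $\dim(G)$ is the minimum cardinality of a resolving set for $G$. *)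

theory Defs
  imports "Graph_Theory.Graph_Theory"
begin

text \<open>
  A finite simple graph is a symmetric loop-free digraph over pairs
  (\<^locale>\<open>pair_graph\<close>), each undirected edge being represented by its two
  orientations. The shortest-path distance is the shortest weighted path length
  with all arc weights equal to 1; it is infinite between vertices that are not connected.
\<close>

definition graph_dist :: "('a, 'b) pre_digraph \<Rightarrow> 'a \<Rightarrow> 'a \<Rightarrow> ereal" where
  "graph_dist G u v = wf_digraph.\<mu> G (\<lambda>_. 1) u v"

definition resolving_set :: "('a, 'b) pre_digraph \<Rightarrow> 'a set \<Rightarrow> bool" where
  "resolving_set G U \<longleftrightarrow>
     U \<subseteq> verts G \<and>
     (\<forall>a \<in> verts G. \<forall>b \<in> verts G. a \<noteq> b \<longrightarrow>
        (\<exists>u \<in> U. graph_dist G a u \<noteq> graph_dist G b u))"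

text \<open>
  The finiteness condition is automatic for finite graphs; it only prevents infinite sets,
  whose \<^const>\<open>card\<close> is 0, from being counted.
\<close>

definition metric_dim :: "('a, 'b) pre_digraph \<Rightarrow> nat" where
  "metric_dim G = (LEAST k. \<exists>U. resolving_set G U \<and> finite U \<and> card U = k)"

datatype prism_vertex = A nat | B nat | C nat

text \<open>The representative of \<open>k\<close> modulo \<open>n\<close> in \<open>{1..n}\<close>, for \<open>k \<ge> 1\<close>.\<close>

definition cyc :: "nat \<Rightarrow> nat \<Rightarrow> nat" where
  "cyc n k = (k - 1) mod n + 1"

definition prism_edges :: "nat \<Rightarrow> prism_vertex rel" where
  "prism_edges n =
     (\<lambda>i. (A i, A (cyc n (i + 2)))) ` {1..n} \<union>
     (\<lambda>i. (B i, B (cyc n (i + 1)))) ` {1..n} \<union>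
     (\<lambda>i. (C i, C (cyc n (i + 1)))) ` {1..n} \<union>
     (\<lambda>i. (A i, B i)) ` {1..n} \<union>
     (\<lambda>i. (B i, C i)) ` {1..n}"

definition P2_prism :: "nat \<Rightarrow> prism_vertex pair_pre_digraph" where
  "P2_prism n =
     \<lparr> pverts = A ` {1..n} \<union> B ` {1..n} \<union> C ` {1..n},
       parcs = prism_edges n \<union> (prism_edges n)\<inverse> \<rparr>"

lemma cyc_in_range: "n \<ge> 1 \<Longrightarrow> cyc n k \<in> {1..n}"
  by (simp add: cyc_def Suc_leI)

lemma cyc_add_neq:
  assumes "0 < d" "d < n" "i \<in> {1..n}"
  shows "cyc n (i + d) \<noteq> i"
proof
  assume "cyc n (i + d) = i"
  with assms have "(i - 1 + d) mod n = (i - 1) mod n"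
    by (simp add: cyc_def)
  then have "n dvd d"
    by (metis add_diff_cancel_left' le_add1 mod_eq_dvd_iff_nat)
  with assms show False
    by (auto dest: dvd_imp_le)
qed

lemma pair_graph_P2_prism:
  assumes "n \<ge> 5"
  shows "pair_graph (P2_prism n)"
proof unfold_locales
  note cyc = cyc_in_range[of n, unfolded atLeastAtMost_iff]
  show "finite (pverts (P2_prism n))" "finite (parcs (P2_prism n))"
    by (auto simp: P2_prism_def prism_edges_def)
  show "symmetric (P2_prism n)"
    by (auto simp: symmetric_def P2_prism_def sym_Un_converse)
  fix e assume e: "e \<in> parcs (P2_prism n)"
  show "fst e \<in> pverts (P2_prism n)" "snd e \<in> pverts (P2_prism n)"
    using e assms cyc by (auto simp: P2_prism_def prism_edges_def)
  show "fst e \<noteq> snd e"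
    using e assms cyc_add_neq[of 1 n] cyc_add_neq[of 2 n]
    by (fastforce simp: P2_prism_def prism_edges_def)
qed

lemma connected_P2_prism:
  assumes "n \<ge> 5"
  shows "connected (P2_prism n)"
proof -
  interpret pair_graph "P2_prism n"
    using assms by (rule pair_graph_P2_prism)
  let ?R = "\<lambda>u v. u \<rightarrow>\<^sup>*\<^bsub>with_proj (P2_prism n)\<^esub> v"
  have edge: "?R u v" "?R v u" if "(u, v) \<in> prism_edges n" for u v
  proof -
    from that have "(u, v) \<in> parcs (P2_prism n)" "(v, u) \<in> parcs (P2_prism n)"
      by (auto simp: P2_prism_def)
    then show "?R u v" "?R v u"
      by auto
  qed
  have B1: "?R (B 1) (B (Suc i)) \<and> ?R (B (Suc i)) (B 1)" if "Suc i \<le> n" for i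
    using that
  proof (induction i)
    case 0
    then have "B 1 \<in> pverts (P2_prism n)" by (auto simp: P2_prism_def)
    then show ?case by simp
  next
    case (Suc i)
    then have "(B (Suc i), B (cyc n (Suc i + 1))) \<in> prism_edges n"
      by (auto simp: prism_edges_def)
    moreover have "cyc n (Suc i + 1) = Suc (Suc i)"
      using Suc.prems by (simp add: cyc_def)
    ultimately have "(B (Suc i), B (Suc (Suc i))) \<in> prism_edges n"
      by simp
    from edge[OF this] Suc show ?case
      by (meson Suc_leD reachable_trans)
  qed
  have B: "?R (B 1) (B i)" "?R (B i) (B 1)" if "i \<in> {1..n}" for i
    using B1[of "i - 1"] that by auto
  have "?R (B 1) v \<and> ?R v (B 1)" if "v \<in> pverts (P2_prism n)" for v
  proof -
    from that consider i where "i \<in> {1..n}" "v = A i" | i where "i \<in> {1..n}" "v = B i"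
      | i where "i \<in> {1..n}" "v = C i"
      by (auto simp: P2_prism_def)
    then show ?thesis
    proof cases
      case (1 i)
      then have "(A i, B i) \<in> prism_edges n" by (auto simp: prism_edges_def)
      from edge[OF this] B[OF 1(1)] 1(2) show ?thesis by (meson reachable_trans)
    next
      case (2 i)
      then show ?thesis using B by simp
    next
      case (3 i)
      then have "(B i, C i) \<in> prism_edges n" by (auto simp: prism_edges_def)
      from edge[OF this] B[OF 3(1)] 3(2) show ?thesis by (meson reachable_trans)
    qed
  qed
  then have "?R u v" if "u \<in> pverts (P2_prism n)" "v \<in> pverts (P2_prism n)" for u v
    using that by (meson reachable_trans)
  then have "u \<rightarrow>\<^sup>*\<^bsub>with_proj (mk_symmetric (P2_prism n))\<^esub> v"
    if "u \<in> pverts (P2_prism n)" "v \<in> pverts (P2_prism n)" for u v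
    using that by (simp add: reachable_mk_symmetricI)
  moreover have "B 1 \<in> pverts (P2_prism n)"
    using assms by (auto simp: P2_prism_def)
  ultimately show ?thesis
    unfolding connected_def strongly_connected_def by auto
qed

end

theory Submission
  imports Defs
begin

text \<open>
  The distances are computed explicitly: a nonnegative function that vanishes only at \<open>u\<close>,
  changes by at most one along an edge and has a descending edge at every vertex other than \<open>u\<close>
  is the distance from \<open>u\<close>.

  For the lower bound, a resolving pair \<open>{u, w}\<close> forces every ball of radius \<open>r\<close> around \<open>u\<close>
  to have at most \<open>(r + 1)\<^sup>2\<close> vertices. This is violated with \<open>r = 2\<close> around \<open>A i\<close>
  (except for \<open>n = 6\<close>), with \<open>r = 1\<close> around \<open>B i\<close>, and with \<open>r = 3\<close> around \<open>C i\<close>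
  for \<open>n \<ge> 7\<close>; the few remaining pairs for \<open>n = 5\<close> and \<open>n = 6\<close> are checked by evaluation.

  For the upper bound, three landmarks are chosen according to \<open>n mod 4\<close>, two of them nearly
  antipodal: \<open>A 1, A 2, A (n / 2 + 1)\<close> for \<open>n = 4k\<close>, \<open>A 1, A 4, A (n / 2)\<close> for \<open>n = 4k + 2\<close>,
  \<open>A 1, A 2, B ((n + 1) / 2)\<close> for \<open>n = 4k + 3\<close>, and \<open>A 1, B 6, B ((n + 3) / 2)\<close>
  for \<open>n = 4k + 1\<close>. On each arc between the landmarks and their antipodes the distances are linear
  in the index once its parity is fixed, so that injectivity is a finite set of linear problems.
\<close>

section \<open>Distance functions and balls\<close>

definition dist_potential :: "'a pair_pre_digraph \<Rightarrow> 'a \<Rightarrow> ('a \<Rightarrow> nat) \<Rightarrow> bool" where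
  "dist_potential G u f \<longleftrightarrow> u \<in> pverts G \<and> f u = 0 \<and>
     (\<forall>(v, w) \<in> parcs G. f v \<le> f w + 1) \<and>
     (\<forall>v \<in> pverts G - {u}. \<exists>w. (v, w) \<in> parcs G \<and> f v = f w + 1)"

context pair_wf_digraph
begin

text \<open>Telescoping along the walk. The end \<open>w\<close> need not be the landmark
  \<open>u\<close>: the ball bound below uses the potential of one landmark on walks that end at or
  start from the other.\<close>

lemma dist_potential_le_walk:
  assumes "dist_potential G u f" "awalk v p w"
  shows "f v \<le> f w + length p"
  using assms(2)
proof (induction p arbitrary: v)
  case Nil
  then show ?case by (simp add: awalk_Nil_iff)
next
  case (Cons e p)
  then have "e \<in> parcs G" "v = fst e" "f (snd e) \<le> f w + length p"
    by (auto simp: awalk_Cons_iff)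
  moreover from this(1,2) assms(1) have "f v \<le> f (snd e) + 1"
    by (cases e) (auto simp: dist_potential_def)
  ultimately show ?case by simp
qed

text \<open>Following descending edges lowers \<open>f\<close> by one each time, and such a walk can
  stop only at \<open>u\<close>.\<close>

lemma dist_potential_walk:
  assumes "dist_potential G u f" "v \<in> pverts G"
  shows "\<exists>p. awalk v p u \<and> length p = f v"
  using assms(2)
proof (induction "f v" arbitrary: v)
  case 0
  \<comment> \<open>Every other vertex has a descending edge and hence a positive value.\<close>
  then have "v = u" using assms(1) by (force simp: dist_potential_def)
  with 0 show ?case by (auto simp: awalk_Nil_iff)
next
  case (Suc k)
  then have "v \<noteq> u" using assms(1) by (auto simp: dist_potential_def)
  then obtain w where w: "(v, w) \<in> parcs G" "f v = f w + 1"
    using assms(1) Suc.prems by (auto simp: dist_potential_def)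
  then obtain p where "awalk w p u" "length p = f w"
    using Suc.hyps(1)[of w] Suc.hyps(2) in_arcsD2 by auto
  with w Suc.prems have "awalk v ((v, w) # p) u \<and> length ((v, w) # p) = f v"
    by (auto simp: awalk_Cons_iff)
  then show ?case by blast
qed

lemma awalk_cost_unit: "awalk_cost (\<lambda>_. 1) p = real (length p)"
  by (induction p) auto

text \<open>\<open>\<mu>\<close> is the infimum of the costs of all walks: the descending walk
  bounds it from above, the Lipschitz estimate from below.\<close>

lemma graph_dist_dist_potential:
  assumes "dist_potential G u f" "v \<in> pverts G"
  shows "graph_dist G v u = ereal (f v)"
proof (rule antisym)
  obtain p where "awalk v p u" "length p = f v"
    using dist_potential_walk[OF assms] by blast
  then show "graph_dist G v u \<le> ereal (f v)"
    unfolding graph_dist_def using min_cost_le_walk_cost[of v p u "\<lambda>_. 1"]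
    by (simp add: awalk_cost_unit)
  have "f u = 0" using assms(1) by (simp add: dist_potential_def)
  then show "ereal (f v) \<le> graph_dist G v u"
    unfolding graph_dist_def \<mu>_def using dist_potential_le_walk[OF assms(1)]
    by (fastforce intro!: INF_greatest simp: awalk_cost_unit)
qed

end

text \<open>If \<open>v\<close> lies within distance \<open>r\<close> of \<open>u\<close>, the pair of distances of \<open>v\<close> to the two landmarks
  \<open>u, w\<close> is one of \<open>(k, d)\<close> with \<open>k \<le> r\<close> and \<open>\<bar>d - d(u, w)\<bar> \<le> k\<close>, which leaves
  \<open>1 + 3 + \<dots> + (2r + 1) = (r + 1)\<^sup>2\<close> possibilities.\<close>

lemma (in pair_sym_digraph) card_ball_le_of_resolving:
  assumes f: "dist_potential G u f" and g: "dist_potential G w g"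
    and inj: "inj_on (\<lambda>v. (f v, g v)) S"
    and S: "S \<subseteq> pverts G" "\<And>v. v \<in> S \<Longrightarrow> f v \<le> r"
  shows "card S \<le> (r + 1)\<^sup>2"
proof -
  let ?T = "SIGMA k:{..r}. {g u - k..g u + k}"
  have "(f v, g v) \<in> ?T" if "v \<in> S" for v
  proof -
    from that S(1) have "v \<in> pverts G" by blast
    then obtain p where p: "awalk v p u" "length p = f v"
      using dist_potential_walk[OF f] by blast
    \<comment> \<open>Arcs are symmetric, so the reversed walk bounds \<open>g u\<close> by
      \<open>g v + f v\<close>, the other half of membership in \<open>?T\<close>.\<close>
    then have "awalk u (rev_path p) v" by simp
    then have "g u \<le> g v + length (rev_path p)"
      by (rule dist_potential_le_walk[OF g])
    moreover have "length (rev_path p) = length p"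
      by (induction p) auto
    ultimately show ?thesis
      using dist_potential_le_walk[OF g p(1)] p(2) S(2)[OF that] by auto
  qed
  then have "card S \<le> card ?T"
    by (intro card_inj_on_le[OF inj]) auto
  also have "\<dots> = (\<Sum>k\<le>r. card {g u - k..g u + k})"
    by simp
  \<comment> \<open>Only an inequality, since \<open>g u - k\<close> is truncated at 0.\<close>
  also have "\<dots> \<le> (\<Sum>k\<le>r. 2 * k + 1)"
    by (intro sum_mono) auto
  also have "\<dots> = (r + 1)\<^sup>2"
    by (induction r) (auto simp: power2_eq_square)
  finally show ?thesis .
qed

section \<open>Distances in terms of the cyclic offset\<close>

text \<open>The distance of two points of an \<open>n\<close>-cycle, \<open>m\<close> being the
  forward offset from one to the other.\<close>

definition gap :: "nat \<Rightarrow> nat \<Rightarrow> nat" where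
  "gap n m = min m (n - m)"

definition hops :: "nat \<Rightarrow> nat" where
  "hops k = (k + 1) div 2"

text \<open>
  \<open>hops k\<close> is the number of steps needed to advance by \<open>k\<close> when one may use edges of length 2
  and a single edge of length 1; \<open>skip m\<close> is the cost of moving by \<open>m\<close> between two
  \<open>A\<close>-vertices, where for odd \<open>m\<close> the single edge costs a detour through the \<open>B\<close>-cycle.
\<close>

definition skip :: "nat \<Rightarrow> nat" where
  "skip m = (if even m then m div 2 else m div 2 + 3)"

text \<open>Offsets stay below \<open>n\<close>, so a move by \<open>d\<close>, forward here or
  backward in \<open>bwd\<close>, may wrap around once. A case distinction in place of
  \<open>mod\<close> keeps the arithmetic linear.\<close>

definition fwd :: "nat \<Rightarrow> nat \<Rightarrow> nat \<Rightarrow> nat" where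
  "fwd n d m = (if m + d < n then m + d else m + d - n)"

definition bwd :: "nat \<Rightarrow> nat \<Rightarrow> nat \<Rightarrow> nat" where
  "bwd n d m = (if d \<le> m then m - d else m + n - d)"

text \<open>Both arcs must be compared: for odd \<open>n\<close> they have opposite parity, and the
  longer one can be cheaper if it is even.\<close>

definition skips :: "nat \<Rightarrow> nat \<Rightarrow> nat" where
  "skips n m = min (skip m) (skip (n - m))"

text \<open>Only the layers of the two vertices matter here; \<open>m\<close> is the offset between their indices.\<close>

fun off_dist :: "nat \<Rightarrow> prism_vertex \<Rightarrow> prism_vertex \<Rightarrow> nat \<Rightarrow> nat" where
  "off_dist n (A u) (A i) m = skips n m"
| "off_dist n (A u) (B i) m = hops (gap n m) + 1"
| "off_dist n (A u) (C i) m = hops (gap n m) + 2"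
| "off_dist n (B u) (A i) m = hops (gap n m) + 1"
| "off_dist n (B u) (B i) m = min (gap n m) (hops (gap n m) + 2)"
| "off_dist n (B u) (C i) m = min (gap n m + 1) (hops (gap n m) + 3)"
| "off_dist n (C u) (A i) m = hops (gap n m) + 2"
| "off_dist n (C u) (B i) m = min (gap n m + 1) (hops (gap n m) + 3)"
| "off_dist n (C u) (C i) m = min (gap n m) (hops (gap n m) + 4)"

section \<open>The distance formulas change by at most one along an edge\<close>

lemma gap_fwd:
  assumes "m < n" "d < n"
  shows "gap n (fwd n d m) \<le> gap n m + d" "gap n m \<le> gap n (fwd n d m) + d"
  using assms by (auto simp: gap_def fwd_def)

lemma hops_le: "a \<le> b + 2 \<Longrightarrow> hops a \<le> hops b + 1"
  "a \<le> b + 1 \<Longrightarrow> hops a \<le> hops b + 1"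
  by (auto simp: hops_def)

lemma skip_add_2: "skip (m + 2) = skip m + 1" "skip (Suc (Suc m)) = skip m + 1"
  by (auto simp: skip_def)

text \<open>Without wrapping, one arc grows by 2 and the other shrinks by 2, and each 2 changes
  \<open>skip\<close> by exactly 1. Wrapping leaves two cases: from \<open>n - 1\<close> to 1 the
  arcs merely swap roles, and from \<open>n - 2\<close> to 0 the cost drops from at most
  \<open>skip 2 = 1\<close> to 0.\<close>

lemma skips_fwd:
  assumes "m < n" "n \<ge> 5"
  shows "skips n m \<le> skips n (fwd n 2 m) + 1" "skips n (fwd n 2 m) \<le> skips n m + 1"
proof -
  consider "m + 2 < n" | "m = n - 1" | "m = n - 2" using assms by linarith
  then have "skips n m \<le> skips n (fwd n 2 m) + 1 \<and> skips n (fwd n 2 m) \<le> skips n m + 1"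
  proof cases
    case 1
    define x where "x = n - m - 2"
    with 1 have "n - m = x + 2" "n - (m + 2) = x" by auto
    with 1 show ?thesis by (simp add: skips_def fwd_def skip_add_2) linarith
  next
    case 2
    then have "fwd n 2 m = 1" "n - m = 1" using assms by (auto simp: fwd_def)
    with 2 show ?thesis by (simp add: skips_def min.commute)
  next
    case 3
    then have "fwd n 2 m = 0" "n - m = 2" using assms by (auto simp: fwd_def)
    then show ?thesis by (simp add: skips_def skip_def)
  qed
  then show "skips n m \<le> skips n (fwd n 2 m) + 1" "skips n (fwd n 2 m) \<le> skips n m + 1"
    by auto
qed

text \<open>\<open>hops\<close> moves by at most 1 when the gap moves by 2, which settles the
  \<open>B\<close> and \<open>C\<close> landmarks. The indices \<open>i\<close> and \<open>j\<close>
  are arbitrary because \<open>off_dist\<close> reads only the layers.\<close>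

lemma off_dist_fwd_A:
  assumes "m < n" "n \<ge> 5"
  shows "off_dist n u (A i) m \<le> off_dist n u (A j) (fwd n 2 m) + 1"
    "off_dist n u (A j) (fwd n 2 m) \<le> off_dist n u (A i) m + 1"
proof -
  have "hops (gap n m) \<le> hops (gap n (fwd n 2 m)) + 1"
    "hops (gap n (fwd n 2 m)) \<le> hops (gap n m) + 1"
    using gap_fwd[of m n 2] assms by (intro hops_le(1); simp)+
  then show "off_dist n u (A i) m \<le> off_dist n u (A j) (fwd n 2 m) + 1"
    "off_dist n u (A j) (fwd n 2 m) \<le> off_dist n u (A i) m + 1"
    using skips_fwd[OF assms] by (cases u; simp)+
qed

lemma min_add_le:
  fixes a b c d x y :: nat
  assumes "a \<le> b + 1" "c \<le> d + 1"
  shows "min (a + x) (c + y) \<le> min (b + x) (d + y) + 1"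
  using assms by linarith

lemma off_dist_fwd_BC:
  assumes "m < n" "n \<ge> 5"
  shows "off_dist n u (B i) m \<le> off_dist n u (B j) (fwd n 1 m) + 1"
    "off_dist n u (B j) (fwd n 1 m) \<le> off_dist n u (B i) m + 1"
    "off_dist n u (C i) m \<le> off_dist n u (C j) (fwd n 1 m) + 1"
    "off_dist n u (C j) (fwd n 1 m) \<le> off_dist n u (C i) m + 1"
proof -
  define a b where "a = gap n m" and "b = gap n (fwd n 1 m)"
  have ab: "a \<le> b + 1" "b \<le> a + 1"
    using gap_fwd[of m n 1] assms by (simp_all add: a_def b_def)
  then have h: "hops a \<le> hops b + 1" "hops b \<le> hops a + 1"
    by (intro hops_le(2); simp)+
  note le = min_add_le[OF ab(1) h(1)] min_add_le[OF ab(2) h(2)]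
  note folds = a_def[symmetric] b_def[symmetric]
  \<comment> \<open>The constants come from \<open>off_dist\<close>: (0, 2) within the
    \<open>B\<close>-layer, (1, 3) between \<open>B\<close> and \<open>C\<close>, (0, 4) within the
    \<open>C\<close>-layer.\<close>
  show "off_dist n u (B i) m \<le> off_dist n u (B j) (fwd n 1 m) + 1"
    using h(1) le(1)[of 0 2] le(1)[of 1 3] by (cases u) (simp_all only: off_dist.simps folds add_0_right)
  show "off_dist n u (B j) (fwd n 1 m) \<le> off_dist n u (B i) m + 1"
    using h(2) le(2)[of 0 2] le(2)[of 1 3] by (cases u) (simp_all only: off_dist.simps folds add_0_right)
  show "off_dist n u (C i) m \<le> off_dist n u (C j) (fwd n 1 m) + 1"
    using h(1) le(1)[of 0 4] le(1)[of 1 3] by (cases u) (simp_all only: off_dist.simps folds add_0_right)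
  show "off_dist n u (C j) (fwd n 1 m) \<le> off_dist n u (C i) m + 1"
    using h(2) le(2)[of 0 4] le(2)[of 1 3] by (cases u) (simp_all only: off_dist.simps folds add_0_right)
qed

lemma hops_mono: "a \<le> b \<Longrightarrow> hops a \<le> hops b"
  by (simp add: hops_def div_le_mono)

lemma skip_eq: "skip k = (if even k then hops k else hops k + 2)"
  by (auto simp: hops_def skip_def elim!: evenE oddE)

text \<open>Compares the \<open>A\<close>-\<open>A\<close> distance with the
  \<open>A\<close>-\<open>B\<close> distance \<open>hops (gap n m) + 1\<close>, as the rungs
  require. Below, \<open>skip\<close> dominates \<open>hops\<close>, which is monotone; above, the
  shorter arc costs at most 2 more than its \<open>hops\<close>, and nothing more if it is
  even.\<close>

lemma skips_bounds:
  shows "hops (gap n m) \<le> skips n m" "skips n m \<le> hops (gap n m) + 2"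
    "even (gap n m) \<Longrightarrow> skips n m = hops (gap n m)"
proof -
  have "hops (gap n m) \<le> hops m" "hops (gap n m) \<le> hops (n - m)"
    by (simp_all add: gap_def hops_mono)
  then show "hops (gap n m) \<le> skips n m"
    by (auto simp: skips_def skip_eq)
  have *: "skips n m \<le> skip (gap n m)"
    by (auto simp: skips_def gap_def min_def)
  then show "skips n m \<le> hops (gap n m) + 2"
    by (auto simp: skip_eq split: if_splits)
  show "skips n m = hops (gap n m)" if "even (gap n m)"
    using * that \<open>hops (gap n m) \<le> skips n m\<close> by (simp add: skip_eq)
qed

lemma gap_hops: "hops k \<le> k" by (simp add: hops_def)

lemma off_dist_rungs:
  assumes "m < n" "n \<ge> 5"
  shows "off_dist n u (A i) m \<le> off_dist n u (B i) m + 1"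
    "off_dist n u (B i) m \<le> off_dist n u (A i) m + 1"
   "off_dist n u (B i) m \<le> off_dist n u (C i) m + 1"
    "off_dist n u (C i) m \<le> off_dist n u (B i) m + 1"
  using skips_bounds[of n m] gap_hops[of "gap n m"] by (cases u; simp; linarith)+

section \<open>Every vertex off the landmark has a descending edge\<close>

lemma gap_descent:
  assumes "0 < m" "m < n" "d \<le> gap n m"
  shows "gap n m = gap n (fwd n d m) + d \<or> gap n m = gap n (bwd n d m) + d"
proof (cases "m \<le> n - m")
  case True
  then have "gap n m = gap n (bwd n d m) + d"
    using assms by (simp add: gap_def bwd_def)
  then show ?thesis ..
next
  case False
  then have "gap n m = gap n (fwd n d m) + d"
    using assms by (auto simp: gap_def fwd_def)
  then show ?thesis ..
qed

text \<open>The excluded value \<open>hops (gap n m) + 2\<close> is the one at which an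
  \<open>A\<close>-vertex descends along its rung. Otherwise the arc attaining the minimum, not
  necessarily the shorter one, is even, and a step of 2 along it descends.\<close>

lemma skips_descent:
  assumes "0 < m" "m < n" "skips n m \<noteq> hops (gap n m) + 2"
  shows "skips n m = skips n (fwd n 2 m) + 1 \<or> skips n m = skips n (bwd n 2 m) + 1"
proof -
  have less: "skips n m < hops (gap n m) + 2"
    using assms(3) skips_bounds(2)[of n m] by linarith
  \<comment> \<open>An odd arc \<open>x\<close> costs \<open>hops x + 2\<close>, hence at least
    \<open>hops (gap n m) + 2\<close>. An even arc that is not empty leaves room for a step of
    2.\<close>
  have ev: "even x \<and> x \<ge> 2" if "skips n m = skip x" "x \<in> {m, n - m}" for x
  proof -
    have "gap n m \<le> x" "x > 0" using that assms by (auto simp: gap_def)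
    then have "even x"
      using hops_mono[of "gap n m" x] that less by (auto simp: skip_eq split: if_splits)
    with \<open>x > 0\<close> show ?thesis by (cases "x = 1") auto
  qed
  consider "skips n m = skip m" "skip m \<le> skip (n - m)"
    | "skips n m = skip (n - m)" "skip (n - m) \<le> skip m"
    unfolding skips_def by linarith
  then show ?thesis
  proof cases
    case 1
    define x where "x = m - 2"
    have "2 \<le> m" using ev[of m] 1 by blast
    then have x: "m = x + 2" "n - x = (n - m) + 2" using assms by (auto simp: x_def)
    then have "skips n (bwd n 2 m) = min (skip x) (skip (n - m) + 1)"
      by (simp add: skips_def bwd_def skip_add_2)
    then show ?thesis using 1 by (simp only: x(1) skip_add_2) linarith
  next
    case 2
    define x where "x = n - m - 2"
    have "2 \<le> n - m" using ev[of "n - m"] 2 by blast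
    then have x: "n - m = x + 2" by (simp only: x_def le_add_diff_inverse2)
    \<comment> \<open>For \<open>x = 0\<close> the step closes the arc and wraps to offset 0;
      otherwise the other arc has grown by 2 and cannot attain the minimum.\<close>
    have "skips n (fwd n 2 m) = skip x"
    proof (cases "x = 0")
      case True
      with x have "m + 2 = n" by linarith
      then have "fwd n 2 m = 0" by (simp add: fwd_def)
      with True show ?thesis by (simp add: skips_def skip_def)
    next
      case False
      with x have "m + 2 < n" "n - (m + 2) = x" by linarith+
      then have "fwd n 2 m = m + 2" "n - (m + 2) = x" by (simp_all add: fwd_def)
      then show ?thesis using 2(2) unfolding skips_def x by (simp only: skip_add_2)
    qed
    then show ?thesis using 2(1) by (simp add: x skip_add_2)
  qed
qed

lemma hops_add_2: "hops (Suc (Suc k)) = hops k + 1"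
  by (simp add: hops_def)

lemma hops_Suc_even: "even k \<Longrightarrow> hops (Suc k) = hops k + 1"
  by (simp add: hops_def)

lemma hops_0_1: "hops 0 = 0" "hops (Suc 0) = 1"
  by (simp_all add: hops_def)

lemma gap_pos: "m < n \<Longrightarrow> 0 < m \<Longrightarrow> 0 < gap n m"
  by (simp add: gap_def)

lemma gap_descent1:
  assumes "m < n" "0 < m"
  obtains x where "x = fwd n 1 m \<or> x = bwd n 1 m" "gap n m = Suc (gap n x)"
  using gap_descent[of m n 1] gap_pos[of m n] assms by auto

lemma off_dist_descent_A_aux:
  assumes "m < n" "1 < gap n m"
  obtains x where "x = fwd n 2 m \<or> x = bwd n 2 m" "hops (gap n m) = hops (gap n x) + 1"
proof -
  have "0 < m" using assms(2) by (auto simp: gap_def)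
  then show thesis
    using gap_descent[of m n 2] assms that[of "fwd n 2 m"] that[of "bwd n 2 m"]
    by (auto simp: hops_add_2)
qed

text \<open>For landmarks in \<open>B\<close> or \<open>C\<close> a step of 2 along the shorter arc
  descends while the gap exceeds 1; at gap 0 or 1 the rung does. Offset 0 is excluded only where the
  vertex would be the landmark itself.\<close>

lemma off_dist_descent_A:
  assumes "m < n" "(\<exists>k. u = A k) \<longrightarrow> 0 < m"
  shows "off_dist n u (A i) m = off_dist n u (B i) m + 1 \<or>
     off_dist n u (A i) m = off_dist n u (A j) (fwd n 2 m) + 1 \<or>
     off_dist n u (A i) m = off_dist n u (A j') (bwd n 2 m) + 1"
proof (cases "\<exists>k. u = A k")
  case True
  then show ?thesis using skips_descent[of m n] assms by auto
next
  case False
  show ?thesis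
  proof (cases "1 < gap n m")
    case True
    then obtain x where "x = fwd n 2 m \<or> x = bwd n 2 m" "hops (gap n m) = hops (gap n x) + 1"
      using off_dist_descent_A_aux assms by blast
    then show ?thesis using False by (cases u) auto
  next
    case le: False
    then have "gap n m = 0 \<or> gap n m = 1" by linarith
    then show ?thesis
      using False by (cases u) (auto simp: hops_0_1)
  qed
qed

text \<open>Seen from \<open>A\<close>: at even gap the rung to \<open>A\<close> descends, at odd
  gap a \<open>B\<close>-step makes the gap even and saves one hop. Seen from \<open>B\<close> or
  \<open>C\<close>: the edge is chosen by which argument of the minimum is attained, the rung to
  \<open>A\<close> for the \<open>hops\<close> route and otherwise the \<open>B\<close>-cycle or the
  rung to \<open>C\<close>.\<close>

lemma off_dist_descent_B:
  assumes "m < n" "(\<exists>k. u = B k) \<longrightarrow> 0 < m"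
  shows "off_dist n u (B i) m = off_dist n u (A i) m + 1 \<or>
     off_dist n u (B i) m = off_dist n u (C i) m + 1 \<or>
     off_dist n u (B i) m = off_dist n u (B j) (fwd n 1 m) + 1 \<or>
     off_dist n u (B i) m = off_dist n u (B j') (bwd n 1 m) + 1"
proof (cases u)
  case (A k)
  show ?thesis
  proof (cases "even (gap n m)")
    case True
    then show ?thesis using A skips_bounds(3) by simp
  next
    case False
    then have "0 < m" by (auto simp: gap_def intro: gr0I)
    then obtain x where x: "x = fwd n 1 m \<or> x = bwd n 1 m" "gap n m = Suc (gap n x)"
      using gap_descent1 assms by blast
    then have "hops (gap n m) = hops (gap n x) + 1"
      using False hops_Suc_even[of "gap n x"] by simp
    then show ?thesis using A x(1) by auto
  qed
next
  case (B k)
  then obtain x where x: "x = fwd n 1 m \<or> x = bwd n 1 m" "gap n m = Suc (gap n x)"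
    using gap_descent1 assms by blast
  \<comment> \<open>If the direct route is optimal at \<open>m\<close>, it is still optimal one step
    nearer, because \<open>hops\<close> drops by at most 1 there.\<close>
  have "min (gap n m) (hops (gap n m) + 2) = hops (gap n m) + 2 \<or>
    min (gap n m) (hops (gap n m) + 2) = min (gap n x) (hops (gap n x) + 2) + 1"
    using hops_le(2)[of "gap n m" "gap n x"] x(2) by linarith
  then show ?thesis using B x(1) by auto
next
  case (C k)
  have "min (gap n m + 1) (hops (gap n m) + 3) = hops (gap n m) + 2 + 1 \<or>
    min (gap n m + 1) (hops (gap n m) + 3) = min (gap n m) (hops (gap n m) + 4) + 1"
    by linarith
  then show ?thesis using C by auto
qed

text \<open>Seen from \<open>A\<close> or \<open>B\<close>, the rung to \<open>B\<close> always
  descends. Seen from \<open>C\<close>, it descends when the detour through \<open>A\<close> is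
  optimal, and a \<open>C\<close>-step does otherwise.\<close>

lemma off_dist_descent_C:
  assumes "m < n" "(\<exists>k. u = C k) \<longrightarrow> 0 < m"
  shows "off_dist n u (C i) m = off_dist n u (B i) m + 1 \<or>
     off_dist n u (C i) m = off_dist n u (C j) (fwd n 1 m) + 1 \<or>
     off_dist n u (C i) m = off_dist n u (C j') (bwd n 1 m) + 1"
proof (cases u)
  case (B k)
  have "min (gap n m + 1) (hops (gap n m) + 3) = min (gap n m) (hops (gap n m) + 2) + 1"
    by linarith
  then show ?thesis using B by simp
next
  case (C k)
  then obtain x where x: "x = fwd n 1 m \<or> x = bwd n 1 m" "gap n m = Suc (gap n x)"
    using gap_descent1 assms by blast
  have "min (gap n m) (hops (gap n m) + 4) = min (gap n m + 1) (hops (gap n m) + 3) + 1 \<or>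
    min (gap n m) (hops (gap n m) + 4) = min (gap n x) (hops (gap n x) + 4) + 1"
    using hops_le(2)[of "gap n m" "gap n x"] x(2) by linarith
  then show ?thesis using C x(1) by auto
qed simp

section \<open>From offsets to the vertices of the prism\<close>

definition cyc_off :: "nat \<Rightarrow> nat \<Rightarrow> nat \<Rightarrow> nat" where
  "cyc_off n u i = (if u \<le> i then i - u else i + n - u)"

primrec index :: "prism_vertex \<Rightarrow> nat" where
  "index (A i) = i"
| "index (B i) = i"
| "index (C i) = i"

text \<open>The landmark comes first, so that \<open>pdist n u\<close> is the candidate potential of
  \<open>u\<close>.\<close>

definition pdist :: "nat \<Rightarrow> prism_vertex \<Rightarrow> prism_vertex \<Rightarrow> nat" where
  "pdist n u v = off_dist n u v (cyc_off n (index u) (index v))"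

lemma cyc_off_less: "i \<in> {1..n} \<Longrightarrow> u \<in> {1..n} \<Longrightarrow> cyc_off n u i < n"
  by (auto simp: cyc_off_def)

lemma cyc_off_eq_0_iff: "i \<in> {1..n} \<Longrightarrow> u \<in> {1..n} \<Longrightarrow> cyc_off n u i = 0 \<longleftrightarrow> i = u"
  by (auto simp: cyc_off_def)

lemma cyc_add:
  assumes "i \<in> {1..n}" "d < n"
  shows "cyc n (i + d) = (if i + d \<le> n then i + d else i + d - n)"
proof (cases "i + d \<le> n")
  case True
  with assms show ?thesis by (simp add: cyc_def)
next
  case False
  then have "i + d - 1 = (i + d - n - 1) + n" by linarith
  then have "(i + d - 1) mod n = (i + d - n - 1) mod n" by simp
  also have "\<dots> = i + d - n - 1"
    by (rule mod_less) (use assms False in auto)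
  finally have "cyc n (i + d) = i + d - n - 1 + 1" by (simp only: cyc_def)
  also have "\<dots> = i + d - n" using False by linarith
  finally show ?thesis using False by simp
qed

lemma cyc_off_cyc:
  assumes "i \<in> {1..n}" "u \<in> {1..n}" "d < n"
  shows "cyc_off n u (cyc n (i + d)) = fwd n d (cyc_off n u i)"
  using assms unfolding cyc_add[OF assms(1,3)] cyc_off_def fwd_def by auto

text \<open>The edges are listed by their forward step, so a backward step from \<open>i\<close> is
  the reversed edge listed at the predecessor \<open>j\<close>.\<close>

lemma cyc_pred:
  assumes "i \<in> {1..n}" "u \<in> {1..n}" "0 < d" "d < n"
  shows "\<exists>j \<in> {1..n}. cyc n (j + d) = i \<and> cyc_off n u j = bwd n d (cyc_off n u i)"
proof (intro bexI conjI)
  let ?j = "if d < i then i - d else i + n - d"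
  show j: "?j \<in> {1..n}" using assms by auto
  show "cyc n (?j + d) = i" unfolding cyc_add[OF j assms(4)] using assms by auto
  show "cyc_off n u ?j = bwd n d (cyc_off n u i)"
    using assms unfolding cyc_off_def bwd_def by auto
qed

lemma mem_pverts_P2_prism [simp]:
  "A i \<in> pverts (P2_prism n) \<longleftrightarrow> i \<in> {1..n}"
  "B i \<in> pverts (P2_prism n) \<longleftrightarrow> i \<in> {1..n}"
  "C i \<in> pverts (P2_prism n) \<longleftrightarrow> i \<in> {1..n}"
  by (auto simp: P2_prism_def)

lemma index_in: "v \<in> pverts (P2_prism n) \<Longrightarrow> index v \<in> {1..n}"
  by (cases v) simp_all

lemma P2_prism_arcs:
  assumes "i \<in> {1..n}"
  shows "(A i, A (cyc n (i + 2))) \<in> parcs (P2_prism n)" "(A (cyc n (i + 2)), A i) \<in> parcs (P2_prism n)"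
    "(B i, B (cyc n (i + 1))) \<in> parcs (P2_prism n)" "(B (cyc n (i + 1)), B i) \<in> parcs (P2_prism n)"
    "(C i, C (cyc n (i + 1))) \<in> parcs (P2_prism n)" "(C (cyc n (i + 1)), C i) \<in> parcs (P2_prism n)"
    "(A i, B i) \<in> parcs (P2_prism n)" "(B i, A i) \<in> parcs (P2_prism n)"
    "(B i, C i) \<in> parcs (P2_prism n)" "(C i, B i) \<in> parcs (P2_prism n)"
  using assms by (auto simp: P2_prism_def prism_edges_def)

text \<open>Stated in both directions because \<open>prism_edges\<close> holds one orientation of
  each edge.\<close>

lemma pdist_lipschitz:
  assumes "n \<ge> 5" "u \<in> pverts (P2_prism n)" "(v, w) \<in> prism_edges n"
  shows "pdist n u v \<le> pdist n u w + 1 \<and> pdist n u w \<le> pdist n u v + 1"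
proof -
  define m where "m i = cyc_off n (index u) i" for i
  have m: "m i < n" "m (cyc n (i + 2)) = fwd n 2 (m i)" "m (cyc n (i + 1)) = fwd n 1 (m i)"
    if "i \<in> {1..n}" for i
    using that assms(1) index_in[OF assms(2)] unfolding m_def
    by (simp_all only: cyc_off_less cyc_off_cyc)
  consider i where "i \<in> {1..n}" "v = A i" "w = A (cyc n (i + 2))"
    | i where "i \<in> {1..n}" "v = B i" "w = B (cyc n (i + 1))"
    | i where "i \<in> {1..n}" "v = C i" "w = C (cyc n (i + 1))"
    | i where "i \<in> {1..n}" "v = A i" "w = B i"
    | i where "i \<in> {1..n}" "v = B i" "w = C i"
    using assms(3) unfolding prism_edges_def by blast
  then show ?thesis
  proof cases
    case (1 i)
    show ?thesis using off_dist_fwd_A[OF m(1) assms(1), OF 1(1)]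
      unfolding pdist_def 1(2,3) index.simps m_def[symmetric] m(2)[OF 1(1)] by blast
  next
    case (2 i)
    show ?thesis using off_dist_fwd_BC(1,2)[OF m(1) assms(1), OF 2(1)]
      unfolding pdist_def 2(2,3) index.simps m_def[symmetric] m(3)[OF 2(1)] by blast
  next
    case (3 i)
    show ?thesis using off_dist_fwd_BC(3,4)[OF m(1) assms(1), OF 3(1)]
      unfolding pdist_def 3(2,3) index.simps m_def[symmetric] m(3)[OF 3(1)] by blast
  next
    case (4 i)
    show ?thesis using off_dist_rungs(1,2)[OF m(1) assms(1), OF 4(1)]
      unfolding pdist_def 4(2,3) index.simps m_def[symmetric] by blast
  next
    case (5 i)
    show ?thesis using off_dist_rungs(3,4)[OF m(1) assms(1), OF 5(1)]
      unfolding pdist_def 5(2,3) index.simps m_def[symmetric] by blast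
  qed
qed

text \<open>Transfers the three descent lemmas: a forward move uses the arc listed at
  \<open>i\<close>, a backward move the reversed arc listed at its predecessor
  \<open>j\<close>.\<close>

lemma pdist_descent:
  assumes "n \<ge> 5" "u \<in> pverts (P2_prism n)" "v \<in> pverts (P2_prism n)" "v \<noteq> u"
  shows "\<exists>w. (v, w) \<in> parcs (P2_prism n) \<and> pdist n u v = pdist n u w + 1"
proof -
  define m where "m i = cyc_off n (index u) i" for i
  have u: "index u \<in> {1..n}" using assms(2) by (rule index_in)
  have d2: "0 < (2::nat)" "2 < n" and d1: "0 < (1::nat)" "1 < n" using assms(1) by auto
  have m: "m i < n" "m (cyc n (i + 2)) = fwd n 2 (m i)" "m (cyc n (i + 1)) = fwd n 1 (m i)"
    if "i \<in> {1..n}" for i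
    using that assms(1) u unfolding m_def
    by (simp_all only: cyc_off_less cyc_off_cyc)
  have pos: "0 < m i" if "i \<in> {1..n}" "i \<noteq> index u" for i
    using that u cyc_off_eq_0_iff[of i n "index u"] by (simp add: m_def)
  show ?thesis
  proof (cases v)
    case (A i)
    with assms(3) have i: "i \<in> {1..n}" by simp
    obtain j where j: "j \<in> {1..n}" "cyc n (j + 2) = i" "m j = bwd n 2 (m i)"
      using cyc_pred[OF i u d2] unfolding m_def by blast
    have "(\<exists>k. u = A k) \<longrightarrow> 0 < m i" using pos[OF i] A assms(4) by force
    from off_dist_descent_A[OF m(1)[OF i] this, of i "cyc n (i + 2)" j]
    have "pdist n u v = pdist n u (B i) + 1 \<or>
      pdist n u v = pdist n u (A (cyc n (i + 2))) + 1 \<or> pdist n u v = pdist n u (A j) + 1"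
      unfolding pdist_def A index.simps m_def[symmetric] m(2)[OF i] j(3) .
    then show ?thesis
      using P2_prism_arcs(7)[OF i] P2_prism_arcs(1)[OF i] P2_prism_arcs(2)[OF j(1)]
      unfolding A j(2) by blast
  next
    case (B i)
    with assms(3) have i: "i \<in> {1..n}" by simp
    obtain j where j: "j \<in> {1..n}" "cyc n (j + 1) = i" "m j = bwd n 1 (m i)"
      using cyc_pred[OF i u d1] unfolding m_def by blast
    have "(\<exists>k. u = B k) \<longrightarrow> 0 < m i" using pos[OF i] B assms(4) by force
    from off_dist_descent_B[OF m(1)[OF i] this, of i "cyc n (i + 1)" j]
    have "pdist n u v = pdist n u (A i) + 1 \<or> pdist n u v = pdist n u (C i) + 1 \<or>
      pdist n u v = pdist n u (B (cyc n (i + 1))) + 1 \<or> pdist n u v = pdist n u (B j) + 1"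
      unfolding pdist_def B index.simps m_def[symmetric] m(3)[OF i] j(3) .
    then show ?thesis
      using P2_prism_arcs(8,9)[OF i] P2_prism_arcs(3)[OF i] P2_prism_arcs(4)[OF j(1)]
      unfolding B j(2) by blast
  next
    case (C i)
    with assms(3) have i: "i \<in> {1..n}" by simp
    obtain j where j: "j \<in> {1..n}" "cyc n (j + 1) = i" "m j = bwd n 1 (m i)"
      using cyc_pred[OF i u d1] unfolding m_def by blast
    have "(\<exists>k. u = C k) \<longrightarrow> 0 < m i" using pos[OF i] C assms(4) by force
    from off_dist_descent_C[OF m(1)[OF i] this, of i "cyc n (i + 1)" j]
    have "pdist n u v = pdist n u (B i) + 1 \<or>
      pdist n u v = pdist n u (C (cyc n (i + 1))) + 1 \<or> pdist n u v = pdist n u (C j) + 1"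
      unfolding pdist_def C index.simps m_def[symmetric] m(3)[OF i] j(3) .
    then show ?thesis
      using P2_prism_arcs(10)[OF i] P2_prism_arcs(5)[OF i] P2_prism_arcs(6)[OF j(1)]
      unfolding C j(2) by blast
  qed
qed

lemma dist_potential_pdist:
  assumes "n \<ge> 5" "u \<in> pverts (P2_prism n)"
  shows "dist_potential (P2_prism n) u (pdist n u)"
proof -
  have "pdist n u u = 0"
    by (cases u) (simp_all add: pdist_def cyc_off_def gap_def skips_def skip_def)
  moreover have "pdist n u v \<le> pdist n u w + 1" if "(v, w) \<in> parcs (P2_prism n)" for v w
    using that pdist_lipschitz[OF assms] by (auto simp: P2_prism_def)
  ultimately show ?thesis
    using assms pdist_descent[OF assms] by (auto simp: dist_potential_def)
qed

lemma graph_dist_P2_prism: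
  assumes "n \<ge> 5" "u \<in> pverts (P2_prism n)" "v \<in> pverts (P2_prism n)"
  shows "graph_dist (P2_prism n) v u = ereal (pdist n u v)"
proof -
  interpret pair_graph "P2_prism n" using assms(1) by (rule pair_graph_P2_prism)
  show ?thesis by (rule graph_dist_dist_potential[OF dist_potential_pdist[OF assms(1,2)] assms(3)])
qed

lemma resolving_set_P2_prism_iff:
  assumes "n \<ge> 5" "U \<subseteq> pverts (P2_prism n)"
  shows "resolving_set (P2_prism n) U \<longleftrightarrow>
    (\<forall>v \<in> pverts (P2_prism n). \<forall>w \<in> pverts (P2_prism n).
       (\<forall>u \<in> U. pdist n u v = pdist n u w) \<longrightarrow> v = w)"
proof -
  have "graph_dist (P2_prism n) v u \<noteq> graph_dist (P2_prism n) w u \<longleftrightarrow> pdist n u v \<noteq> pdist n u w"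
    if "v \<in> pverts (P2_prism n)" "w \<in> pverts (P2_prism n)" "u \<in> U" for u v w
    using that assms(2) graph_dist_P2_prism[OF assms(1)] by (simp add: subset_iff)
  then show ?thesis
    using assms(2) unfolding resolving_set_def with_proj_simps by metis
qed

section \<open>No two vertices resolve the graph\<close>

text \<open>The landmarks may coincide, so that resolving sets with fewer than two elements are
  covered as well.\<close>

definition resolves :: "nat \<Rightarrow> prism_vertex \<Rightarrow> prism_vertex \<Rightarrow> bool" where
  "resolves n u w \<longleftrightarrow> inj_on (\<lambda>v. (pdist n u v, pdist n w v)) (pverts (P2_prism n))"

lemma cyc_off_shift:
  assumes "u \<in> {1..n}" "m < n"
  shows "cyc_off n u (cyc n (u + m)) = m"
  using assms unfolding cyc_add[OF assms] cyc_off_def by auto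

lemma cyc_shift_inj:
  assumes "u \<in> {1..n}"
  shows "inj_on (\<lambda>m. cyc n (u + m)) {..<n}"
  using cyc_off_shift[OF assms] by (intro inj_on_inverseI[where g = "cyc_off n u"]) simp

text \<open>The vertices at the offsets \<open>P\<close>, \<open>Q\<close>, \<open>R\<close> from the landmark in the three layers.\<close>

lemma card_le_of_resolves:
  assumes n: "n \<ge> 5" and u: "u \<in> pverts (P2_prism n)" and w: "w \<in> pverts (P2_prism n)"
    and res: "resolves n u w"
    and sub: "P \<subseteq> {..<n}" "Q \<subseteq> {..<n}" "R \<subseteq> {..<n}"
    and le: "\<And>m i. m \<in> P \<Longrightarrow> off_dist n u (A i) m \<le> r"
      "\<And>m i. m \<in> Q \<Longrightarrow> off_dist n u (B i) m \<le> r"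
      "\<And>m i. m \<in> R \<Longrightarrow> off_dist n u (C i) m \<le> r"
  shows "card P + card Q + card R \<le> (r + 1)\<^sup>2"
proof -
  interpret pair_graph "P2_prism n" using n by (rule pair_graph_P2_prism)
  define f where "f m = cyc n (index u + m)" for m
  have iu: "index u \<in> {1..n}" using u by (rule index_in)
  have inj: "inj_on f {..<n}" unfolding f_def by (rule cyc_shift_inj[OF iu])
  let ?S = "A ` f ` P \<union> B ` f ` Q \<union> C ` f ` R"
  have f_in: "f m \<in> {1..n}" for m unfolding f_def using n by (intro cyc_in_range) simp
  then have S: "?S \<subseteq> pverts (P2_prism n)" by auto
  have fin: "finite P" "finite Q" "finite R" using sub finite_subset[OF _ finite_lessThan] by auto
  have "card ?S = card (A ` f ` P) + card (B ` f ` Q) + card (C ` f ` R)"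
    using fin by (subst card_Un_disjoint; (subst card_Un_disjoint)?) auto
  also have "\<dots> = card P + card Q + card R"
    using inj_on_subset[OF inj sub(1)] inj_on_subset[OF inj sub(2)] inj_on_subset[OF inj sub(3)]
    by (simp add: card_image inj_on_def)
  finally have "card ?S = card P + card Q + card R" .
  moreover have "card ?S \<le> (r + 1)\<^sup>2"
  proof (rule card_ball_le_of_resolving[OF dist_potential_pdist[OF n u] dist_potential_pdist[OF n w] _ S])
    show "inj_on (\<lambda>v. (pdist n u v, pdist n w v)) ?S"
      using res S unfolding resolves_def by (rule inj_on_subset)
    have off: "cyc_off n (index u) (f m) = m" if "m < n" for m
      unfolding f_def by (rule cyc_off_shift[OF iu that])
    show "pdist n u v \<le> r" if "v \<in> ?S" for v
      using that sub le by (auto simp: pdist_def off subset_iff)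
  qed
  ultimately show ?thesis by simp
qed

text \<open>Radius 2 reaches the offsets 0, 2, 4 in the \<open>A\<close>-layer and 0, 1, 2 in the
  \<open>B\<close>-layer, up to sign, and 0 in the \<open>C\<close>-layer. In general these are 5 +
  5 + 1 = 11 > 9 vertices; for \<open>n = 6\<close> collisions leave only 9.\<close>

lemma not_resolves_A:
  assumes "n \<ge> 5" "n \<noteq> 6" "A i \<in> pverts (P2_prism n)" "w \<in> pverts (P2_prism n)"
  shows "\<not> resolves n (A i) w"
proof
  assume res: "resolves n (A i) w"
  let ?P = "{0, 2, n - 2, 4, n - 4}" and ?Q = "{0, 1, 2, n - 1, n - 2}" and ?R = "{0::nat}"
  have *: "card ?P + card ?Q + card ?R \<le> (2 + 1)\<^sup>2"
  proof (rule card_le_of_resolves[OF assms(1,3,4) res])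
    show "off_dist n (A i) (A k) m \<le> 2" if "m \<in> ?P" for m k
      using that assms(1) by (auto simp: skips_def skip_def min_le_iff_disj)
    show "off_dist n (A i) (B k) m \<le> 2" if "m \<in> ?Q" for m k
      using that assms(1) by (auto simp: hops_def gap_def min_def)
    show "off_dist n (A i) (C k) m \<le> 2" if "m \<in> ?R" for m k
      using that by (simp add: hops_def gap_def)
  qed (use assms(1) in auto)
  have Q: "card ?Q = 5" using assms(1) by (auto simp: card_insert_if)
  \<comment> \<open>For \<open>n = 8\<close> the offsets 4 and \<open>n - 4\<close> coincide, and 4
    + 5 + 1 = 10 still exceeds 9.\<close>
  have P: "4 \<le> card ?P"
  proof (cases "n = 8")
    case False
    consider "n = 5" | "n = 7" | "n \<ge> 9" using False assms(1,2) by linarith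
    then have "card ?P = 5" by cases (auto simp: card_insert_if)
    then show ?thesis by simp
  qed simp
  show False using * by (simp only: Q power2_eq_square) (use P in simp)
qed

text \<open>A \<open>B\<close>-vertex has degree 4, so its closed neighbourhood has 5 > 4
  vertices.\<close>

lemma not_resolves_B:
  assumes "n \<ge> 5" "B i \<in> pverts (P2_prism n)" "w \<in> pverts (P2_prism n)"
  shows "\<not> resolves n (B i) w"
proof
  assume res: "resolves n (B i) w"
  let ?Q = "{0, 1, n - 1}" and ?P = "{0::nat}"
  have *: "card ?P + card ?Q + card ?P \<le> (1 + 1)\<^sup>2"
  proof (rule card_le_of_resolves[OF assms(1,2,3) res])
    show "off_dist n (B i) (B k) m \<le> 1" if "m \<in> ?Q" for m k
      using that assms(1) by (auto simp: hops_def gap_def min_def)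
  qed (use assms(1) in \<open>auto simp: hops_def gap_def\<close>)
  have Q: "card ?Q = 3" using assms(1) by (auto simp: card_insert_if)
  show False using * unfolding Q by (simp add: power2_eq_square)
qed

text \<open>Radius 3 reaches offsets up to 2 in the \<open>A\<close>- and \<open>B\<close>-layers
  and up to 3 in the \<open>C\<close>-layer: 5 + 5 + 7 = 17 > 16. The seven offsets in the last
  layer are distinct from \<open>n = 7\<close> on.\<close>

lemma not_resolves_C:
  assumes "n \<ge> 7" "C i \<in> pverts (P2_prism n)" "w \<in> pverts (P2_prism n)"
  shows "\<not> resolves n (C i) w"
proof
  assume res: "resolves n (C i) w"
  let ?P = "{0, 1, 2, n - 1, n - 2}" and ?R = "{0, 1, 2, 3, n - 1, n - 2, n - 3}"
  have *: "card ?P + card ?P + card ?R \<le> (3 + 1)\<^sup>2"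
  proof (rule card_le_of_resolves[OF _ assms(2,3) res])
    show "off_dist n (C i) (A k) m \<le> 3" if "m \<in> ?P" for m k
      using that assms(1) by (auto simp: hops_def gap_def min_def)
    show "off_dist n (C i) (B k) m \<le> 3" if "m \<in> ?P" for m k
      using that assms(1) by (auto simp: hops_def gap_def min_def)
    show "off_dist n (C i) (C k) m \<le> 3" if "m \<in> ?R" for m k
      using that assms(1) by (auto simp: hops_def gap_def min_def)
  qed (use assms(1) in auto)
  have P: "card ?P = 5" using assms(1) by (auto simp: card_insert_if)
  have R: "card ?R = 7" using assms(1) by (auto simp: card_insert_if)
  show False using * by (simp only: P R) simp
qed

section \<open>The remaining pairs for n = 5 and n = 6\<close>

definition prism_list :: "nat \<Rightarrow> prism_vertex list" where
  "prism_list n = map A [1..<Suc n] @ map B [1..<Suc n] @ map C [1..<Suc n]"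

lemma set_prism_list: "set (prism_list n) = pverts (P2_prism n)"
  by (auto simp: prism_list_def P2_prism_def image_iff simp del: upt_Suc)

lemma resolves_sym: "resolves n u w \<longleftrightarrow> resolves n w u"
  by (auto simp: resolves_def inj_on_def)

lemma resolves_code:
  "resolves n u w \<longleftrightarrow> distinct (map (\<lambda>v. (pdist n u v, pdist n w v)) (prism_list n))"
proof -
  have "distinct (prism_list n)"
    by (auto simp: prism_list_def distinct_map inj_on_def simp del: upt_Suc)
  then show ?thesis by (simp add: resolves_def distinct_map set_prism_list)
qed

text \<open>For \<open>n = 5\<close> the ball counts exclude landmarks in \<open>A\<close> and
  \<open>B\<close>, which leaves pairs within the \<open>C\<close>-layer.\<close>

lemma unresolved_5: "\<forall>u \<in> set (map C [1..<6]). \<forall>w \<in> set (map C [1..<6]).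
   \<not> distinct (map (\<lambda>v. (pdist 5 u v, pdist 5 w v)) (prism_list 5))"
  by code_simp

text \<open>For \<open>n = 6\<close> only landmarks in \<open>B\<close> are excluded by
  counting.\<close>

lemma unresolved_6: "\<forall>u \<in> set (map A [1..<7] @ map C [1..<7]). \<forall>w \<in> set (map A [1..<7] @ map C [1..<7]).
   \<not> distinct (map (\<lambda>v. (pdist 6 u v, pdist 6 w v)) (prism_list 6))"
  by code_simp

lemma not_resolves:
  assumes "n \<ge> 5" "u \<in> pverts (P2_prism n)" "w \<in> pverts (P2_prism n)"
  shows "\<not> resolves n u w"
proof (cases "n \<le> 6")
  case True
  show ?thesis
  \<comment> \<open>Each ball count concerns a single landmark whatever the other is, so by symmetry
    it suffices that one of the two lies in a layer already excluded.\<close>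
  proof (cases "(\<exists>i. u = B i) \<or> (\<exists>i. w = B i)")
    case True
    then show ?thesis using not_resolves_B assms resolves_sym by metis
  next
    case notB: False
    show ?thesis
    proof (cases "n = 6")
      case True
      have "v \<in> set (map A [1..<7] @ map C [1..<7])"
        if "v \<in> pverts (P2_prism n)" "\<nexists>i. v = B i" for v
        using that True by (cases v) (auto simp: image_iff simp del: upt_rec_numeral)
      then have "u \<in> set (map A [1..<7] @ map C [1..<7])" "w \<in> set (map A [1..<7] @ map C [1..<7])"
        using notB assms by blast+
      with unresolved_6 show ?thesis unfolding True resolves_code by blast
    next
      case False
      with \<open>n \<le> 6\<close> assms(1) have n: "n = 5" by simp
      show ?thesis
      proof (cases "(\<exists>i. u = A i) \<or> (\<exists>i. w = A i)")
        case True
        then show ?thesis using not_resolves_A[of n] assms resolves_sym False by metis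
      next
        case notA: False
        have "v \<in> set (map C [1..<6])"
          if "v \<in> pverts (P2_prism n)" "\<nexists>i. v = A i" "\<nexists>i. v = B i" for v
          using that n by (cases v) (auto simp: image_iff simp del: upt_rec_numeral)
        then have "u \<in> set (map C [1..<6])" "w \<in> set (map C [1..<6])"
          using notA notB assms by blast+
        with unresolved_5 show ?thesis unfolding n resolves_code by blast
      qed
    qed
  qed
next
  case False
  then have n: "n \<ge> 7" "n \<noteq> 6" by auto
  show ?thesis
  proof (cases u)
    case (A i)
    with assms n not_resolves_A[of n i w] show ?thesis by simp
  next
    case (B i)
    with assms not_resolves_B[of n i w] show ?thesis by simp
  next
    case (C i)
    with assms n not_resolves_C[of n i w] show ?thesis by simp
  qed
qed

lemma card_resolving_set_ge_3:
  assumes n: "n \<ge> 5" and U: "resolving_set (P2_prism n) U" "finite U"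
  shows "card U \<ge> 3"
proof (rule ccontr)
  assume "\<not> card U \<ge> 3"
  then consider "card U = 0" | "card U = 1" | "card U = 2" by linarith
  then obtain a b where "U \<subseteq> {a, b}"
  proof cases
    case 1
    with U(2) that show thesis by simp
  next
    case 2
    then obtain a where "U = {a}" by (rule card_1_singletonE)
    with that[of a a] show thesis by simp
  next
    case 3
    then show thesis using that unfolding card_2_iff by blast
  qed
  have sub: "U \<subseteq> pverts (P2_prism n)" using U(1) by (simp add: resolving_set_def)
  \<comment> \<open>\<open>A 1\<close> stands in for \<open>a\<close> or \<open>b\<close> when they
    do not belong to \<open>U\<close>; additional landmarks keep the set resolving.\<close>
  have "A 1 \<in> pverts (P2_prism n)" using n by simp
  with \<open>U \<subseteq> {a, b}\<close> sub obtain u w where uw: "U \<subseteq> {u, w}"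
    "u \<in> pverts (P2_prism n)" "w \<in> pverts (P2_prism n)"
    by (cases "a \<in> U"; cases "b \<in> U") blast+
  have "resolves n u w"
    using U(1) uw(1) unfolding resolving_set_P2_prism_iff[OF n sub] resolves_def inj_on_def by blast
  with not_resolves[OF n uw(2,3)] show False by contradiction
qed

section \<open>Gaps to the three landmarks\<close>

definition cyc_gap :: "nat \<Rightarrow> nat \<Rightarrow> nat \<Rightarrow> nat" where
  "cyc_gap n u i = gap n (cyc_off n u i)"

definition cyc_skips :: "nat \<Rightarrow> nat \<Rightarrow> nat \<Rightarrow> nat" where
  "cyc_skips n u i = skips n (cyc_off n u i)"

lemma pdist_simps:
  "pdist n (A u) (A i) = cyc_skips n u i"
  "pdist n (A u) (B i) = hops (cyc_gap n u i) + 1"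
  "pdist n (A u) (C i) = hops (cyc_gap n u i) + 2"
  "pdist n (B u) (A i) = hops (cyc_gap n u i) + 1"
  "pdist n (B u) (B i) = min (cyc_gap n u i) (hops (cyc_gap n u i) + 2)"
  "pdist n (B u) (C i) = min (cyc_gap n u i + 1) (hops (cyc_gap n u i) + 3)"
  "pdist n (C u) (A i) = hops (cyc_gap n u i) + 2"
  "pdist n (C u) (B i) = min (cyc_gap n u i + 1) (hops (cyc_gap n u i) + 3)"
  "pdist n (C u) (C i) = min (cyc_gap n u i) (hops (cyc_gap n u i) + 4)"
  by (simp_all add: pdist_def cyc_gap_def cyc_skips_def)

text \<open>Passing from the offset to its complement only swaps the two arcs, so the gap alone
  determines the cost.\<close>

lemma cyc_skips_eq:
  assumes "u \<in> {1..n}" "i \<in> {1..n}"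
  shows "cyc_skips n u i = min (skip (cyc_gap n u i)) (skip (n - cyc_gap n u i))"
  using cyc_off_less[OF assms(2,1)] by (auto simp: cyc_skips_def cyc_gap_def skips_def gap_def min_def)

text \<open>For even \<open>n\<close> both arcs have the same parity and the shorter one is
  optimal.\<close>

lemma cyc_skips_even_n:
  assumes "even n" "u \<in> {1..n}" "i \<in> {1..n}"
  shows "cyc_gap n u i = 2 * x \<Longrightarrow> cyc_skips n u i = x" "cyc_gap n u i = 2 * x + 1 \<Longrightarrow> cyc_skips n u i = x + 3"
proof -
  have le: "2 * cyc_gap n u i \<le> n" by (auto simp: cyc_gap_def gap_def)
  show "cyc_skips n u i = x" if "cyc_gap n u i = 2 * x"
    using that le assms(1) by (auto simp: cyc_skips_eq[OF assms(2,3)] skip_def elim!: evenE)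
  show "cyc_skips n u i = x + 3" if "cyc_gap n u i = 2 * x + 1"
    using that le assms(1) by (auto simp: cyc_skips_eq[OF assms(2,3)] skip_def elim!: evenE)
qed

text \<open>For odd \<open>n\<close> the arcs have opposite parity. An even gap is optimal; an odd
  gap competes with the complementary even arc of length \<open>2 * y\<close>.\<close>

lemma cyc_skips_odd_n:
  assumes "u \<in> {1..n}" "i \<in> {1..n}"
  shows "odd n \<Longrightarrow> cyc_gap n u i = 2 * x \<Longrightarrow> cyc_skips n u i = x"
    "cyc_gap n u i = 2 * x + 1 \<Longrightarrow> n = 2 * x + 2 * y + 1 \<Longrightarrow> cyc_skips n u i = min (x + 3) y"
proof -
  have le: "2 * cyc_gap n u i \<le> n" by (auto simp: cyc_gap_def gap_def)
  show "cyc_skips n u i = x" if "odd n" "cyc_gap n u i = 2 * x"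
    using that le by (auto simp: cyc_skips_eq[OF assms] skip_def elim!: oddE)
  show "cyc_skips n u i = min (x + 3) y" if "cyc_gap n u i = 2 * x + 1" "n = 2 * x + 2 * y + 1"
  proof -
    have "n - cyc_gap n u i = 2 * y" using that by simp
    then show ?thesis by (simp add: cyc_skips_eq[OF assms] that(1) skip_def)
  qed
qed

text \<open>
  The parameters satisfy \<open>p + q = const\<close> so that all gaps are written without subtraction and with
  visible parity. The values of \<open>j\<close> start above the sporadic cases \<open>n = 5, 6, 9, 10, 13, 17\<close>.
\<close>

lemma gap_cases_mod_0:
  fixes i j n :: nat
  assumes n: "n = 4 * j + 8" and i: "i \<in> {1..n}"
  obtains
    "i = 1"
      "cyc_gap n 1 i = 0" "cyc_gap n 2 i = 1" "cyc_gap n (2 * j + 5) i = 2 * j + 4"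
      "cyc_skips n 1 i = 0" "cyc_skips n 2 i = 0 + 3" "cyc_skips n (2 * j + 5) i = j + 2"
  | p q where "p + q = j + 1" "i = 2 * p + 3"
      "cyc_gap n 1 i = 2 * p + 2" "cyc_gap n 2 i = 2 * p + 1" "cyc_gap n (2 * j + 5) i = 2 * q"
      "cyc_skips n 1 i = p + 1" "cyc_skips n 2 i = p + 3" "cyc_skips n (2 * j + 5) i = q"
  | p q where "p + q = j + 1" "i = 2 * p + 2"
      "cyc_gap n 1 i = 2 * p + 1" "cyc_gap n 2 i = 2 * p" "cyc_gap n (2 * j + 5) i = 2 * q + 1"
      "cyc_skips n 1 i = p + 3" "cyc_skips n 2 i = p" "cyc_skips n (2 * j + 5) i = q + 3"
  | p q where "p + q = j" "i = 2 * j + 2 * p + 7"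
      "cyc_gap n 1 i = 2 * q + 2" "cyc_gap n 2 i = 2 * q + 3" "cyc_gap n (2 * j + 5) i = 2 * p + 2"
      "cyc_skips n 1 i = q + 1" "cyc_skips n 2 i = q + 1 + 3" "cyc_skips n (2 * j + 5) i = p + 1"
  | p q where "p + q = j + 1" "i = 2 * j + 2 * p + 6"
      "cyc_gap n 1 i = 2 * q + 1" "cyc_gap n 2 i = 2 * q + 2" "cyc_gap n (2 * j + 5) i = 2 * p + 1"
      "cyc_skips n 1 i = q + 3" "cyc_skips n 2 i = q + 1" "cyc_skips n (2 * j + 5) i = p + 3"
proof -
  \<comment> \<open>Cut at the landmarks 1, 2, \<open>2 * j + 5\<close> and their antipodes
    \<open>2 * j + 5\<close>, \<open>2 * j + 6\<close>, 1, so that each gap is linear on every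
    piece.\<close>
  consider "i = 1" | "2 \<le> i" "i \<le> 2 * j + 5" | "2 * j + 6 \<le> i" "i \<le> 4 * j + 8"
    using i unfolding n by force
  then show thesis
  proof cases
    case 1
    then have i_eq: "i = 1" .
    have g0: "cyc_gap n 1 i = 0" and g1: "cyc_gap n 2 i = 1" and g2: "cyc_gap n (2 * j + 5) i = 2 * j + 4"
      by (auto simp: cyc_gap_def gap_def cyc_off_def n i_eq)
    moreover have "cyc_skips n 1 i = 0"
      by (rule cyc_skips_even_n(1)) (use i_eq g0 in \<open>simp_all add: n\<close>)
    moreover have "cyc_skips n 2 i = 0 + 3"
      by (rule cyc_skips_even_n(2)) (use i_eq g1 in \<open>simp_all add: n\<close>)
    moreover have "cyc_skips n (2 * j + 5) i = j + 2"
      by (rule cyc_skips_even_n(1)) (use i_eq g2 in \<open>simp_all add: n\<close>)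
    ultimately show thesis
      using that(1) i_eq g0 g1 g2 by blast
  next
    case 2
    have "\<exists>p. i = 2 * p + 2 \<or> i = 2 * p + 3"
      using 2(1) by presburger
    then obtain p where "i = 2 * p + 2 \<or> i = 2 * p + 3" by blast
    then show thesis
    proof
      assume i_eq: "i = 2 * p + 2"
      with 2(2) have "p \<le> j + 1" by simp
      then obtain q where q: "p + q = j + 1" using le_Suc_ex by metis
      have g0: "cyc_gap n 1 i = 2 * p + 1" and g1: "cyc_gap n 2 i = 2 * p" and g2: "cyc_gap n (2 * j + 5) i = 2 * q + 1"
        using q by (auto simp: cyc_gap_def gap_def cyc_off_def n i_eq)
      moreover have "cyc_skips n 1 i = p + 3"
        by (rule cyc_skips_even_n(2)) (use q i_eq g0 in \<open>simp_all add: n\<close>)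
      moreover have "cyc_skips n 2 i = p"
        by (rule cyc_skips_even_n(1)) (use q i_eq g1 in \<open>simp_all add: n\<close>)
      moreover have "cyc_skips n (2 * j + 5) i = q + 3"
        by (rule cyc_skips_even_n(2)) (use q i_eq g2 in \<open>simp_all add: n\<close>)
      ultimately show thesis
        using that(3) q i_eq g0 g1 g2 by blast
    next
      assume i_eq: "i = 2 * p + 3"
      with 2(2) have "p \<le> j + 1" by simp
      then obtain q where q: "p + q = j + 1" using le_Suc_ex by metis
      have g0: "cyc_gap n 1 i = 2 * p + 2" and g1: "cyc_gap n 2 i = 2 * p + 1" and g2: "cyc_gap n (2 * j + 5) i = 2 * q"
        using q by (auto simp: cyc_gap_def gap_def cyc_off_def n i_eq)
      moreover have "cyc_skips n 1 i = p + 1"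
        by (rule cyc_skips_even_n(1)) (use q i_eq g0 in \<open>simp_all add: n\<close>)
      moreover have "cyc_skips n 2 i = p + 3"
        by (rule cyc_skips_even_n(2)) (use q i_eq g1 in \<open>simp_all add: n\<close>)
      moreover have "cyc_skips n (2 * j + 5) i = q"
        by (rule cyc_skips_even_n(1)) (use q i_eq g2 in \<open>simp_all add: n\<close>)
      ultimately show thesis
        using that(2) q i_eq g0 g1 g2 by blast
    qed
  next
    case 3
    have "\<exists>p. i = 2 * j + 2 * p + 6 \<or> i = 2 * j + 2 * p + 7"
      using 3(1) by presburger
    then obtain p where "i = 2 * j + 2 * p + 6 \<or> i = 2 * j + 2 * p + 7" by blast
    then show thesis
    proof
      assume i_eq: "i = 2 * j + 2 * p + 6"
      with 3(2) have "p \<le> j + 1" by simp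
      then obtain q where q: "p + q = j + 1" using le_Suc_ex by metis
      have g0: "cyc_gap n 1 i = 2 * q + 1" and g1: "cyc_gap n 2 i = 2 * q + 2" and g2: "cyc_gap n (2 * j + 5) i = 2 * p + 1"
        using q by (auto simp: cyc_gap_def gap_def cyc_off_def n i_eq)
      moreover have "cyc_skips n 1 i = q + 3"
        by (rule cyc_skips_even_n(2)) (use q i_eq g0 in \<open>simp_all add: n\<close>)
      moreover have "cyc_skips n 2 i = q + 1"
        by (rule cyc_skips_even_n(1)) (use q i_eq g1 in \<open>simp_all add: n\<close>)
      moreover have "cyc_skips n (2 * j + 5) i = p + 3"
        by (rule cyc_skips_even_n(2)) (use q i_eq g2 in \<open>simp_all add: n\<close>)
      ultimately show thesis
        using that(5) q i_eq g0 g1 g2 by blast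
    next
      assume i_eq: "i = 2 * j + 2 * p + 7"
      with 3(2) have "p \<le> j" by simp
      then obtain q where q: "p + q = j" using le_Suc_ex by metis
      have g0: "cyc_gap n 1 i = 2 * q + 2" and g1: "cyc_gap n 2 i = 2 * q + 3" and g2: "cyc_gap n (2 * j + 5) i = 2 * p + 2"
        using q by (auto simp: cyc_gap_def gap_def cyc_off_def n i_eq)
      moreover have "cyc_skips n 1 i = q + 1"
        by (rule cyc_skips_even_n(1)) (use q i_eq g0 in \<open>simp_all add: n\<close>)
      moreover have "cyc_skips n 2 i = q + 1 + 3"
        by (rule cyc_skips_even_n(2)) (use q i_eq g1 in \<open>simp_all add: n\<close>)
      moreover have "cyc_skips n (2 * j + 5) i = p + 1"
        by (rule cyc_skips_even_n(1)) (use q i_eq g2 in \<open>simp_all add: n\<close>)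
      ultimately show thesis
        using that(4) q i_eq g0 g1 g2 by blast
    qed
  qed
qed

text \<open>The five indices from landmark 1 up to landmark 6, and the five indices
  \<open>2 * j + 12\<close> to \<open>2 * j + 16\<close> between the antipodes of these two, are
  listed singly. \<open>cyc_skips\<close> is recorded for landmark 1 alone because the other two
  landmarks lie in the \<open>B\<close>-layer.\<close>

lemma gap_cases_mod_1:
  fixes i j n :: nat
  assumes n: "n = 4 * j + 21" and i: "i \<in> {1..n}"
  obtains
    "i = 1"
      "cyc_gap n 1 i = 0" "cyc_gap n 6 i = 5" "cyc_gap n (2 * j + 12) i = 2 * j + 10"
      "cyc_skips n 1 i = 0"
  | "i = 2"
      "cyc_gap n 1 i = 1" "cyc_gap n 6 i = 4" "cyc_gap n (2 * j + 12) i = 2 * j + 10"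
      "cyc_skips n 1 i = min (0 + 3) (2 * j + 10)"
  | "i = 3"
      "cyc_gap n 1 i = 2" "cyc_gap n 6 i = 3" "cyc_gap n (2 * j + 12) i = 2 * j + 9"
      "cyc_skips n 1 i = 1"
  | "i = 4"
      "cyc_gap n 1 i = 3" "cyc_gap n 6 i = 2" "cyc_gap n (2 * j + 12) i = 2 * j + 8"
      "cyc_skips n 1 i = min (1 + 3) (2 * j + 9)"
  | "i = 5"
      "cyc_gap n 1 i = 4" "cyc_gap n 6 i = 1" "cyc_gap n (2 * j + 12) i = 2 * j + 7"
      "cyc_skips n 1 i = 2"
  | p q where "p + q = j + 2" "i = 2 * p + 6"
      "cyc_gap n 1 i = 2 * p + 5" "cyc_gap n 6 i = 2 * p" "cyc_gap n (2 * j + 12) i = 2 * q + 2"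
      "cyc_skips n 1 i = min (p + 2 + 3) (p + 2 * q + 4)"
  | p q where "p + q = j + 2" "i = 2 * p + 7"
      "cyc_gap n 1 i = 2 * p + 6" "cyc_gap n 6 i = 2 * p + 1" "cyc_gap n (2 * j + 12) i = 2 * q + 1"
      "cyc_skips n 1 i = p + 3"
  | "i = 2 * j + 12"
      "cyc_gap n 1 i = 2 * j + 10" "cyc_gap n 6 i = 2 * j + 6" "cyc_gap n (2 * j + 12) i = 0"
      "cyc_skips n 1 i = j + 5"
  | "i = 2 * j + 13"
      "cyc_gap n 1 i = 2 * j + 9" "cyc_gap n 6 i = 2 * j + 7" "cyc_gap n (2 * j + 12) i = 1"
      "cyc_skips n 1 i = min (j + 4 + 3) (j + 6)"
  | "i = 2 * j + 14"
      "cyc_gap n 1 i = 2 * j + 8" "cyc_gap n 6 i = 2 * j + 8" "cyc_gap n (2 * j + 12) i = 2"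
      "cyc_skips n 1 i = j + 4"
  | "i = 2 * j + 15"
      "cyc_gap n 1 i = 2 * j + 7" "cyc_gap n 6 i = 2 * j + 9" "cyc_gap n (2 * j + 12) i = 3"
      "cyc_skips n 1 i = min (j + 3 + 3) (j + 7)"
  | "i = 2 * j + 16"
      "cyc_gap n 1 i = 2 * j + 6" "cyc_gap n 6 i = 2 * j + 10" "cyc_gap n (2 * j + 12) i = 4"
      "cyc_skips n 1 i = j + 3"
  | p q where "p + q = j + 2" "i = 2 * j + 2 * p + 17"
      "cyc_gap n 1 i = 2 * q + 1" "cyc_gap n 6 i = 2 * q + 6" "cyc_gap n (2 * j + 12) i = 2 * p + 5"
      "cyc_skips n 1 i = min (q + 3) (2 * p + q + 6)"
  | p q where "p + q = j + 1" "i = 2 * j + 2 * p + 18"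
      "cyc_gap n 1 i = 2 * q + 2" "cyc_gap n 6 i = 2 * q + 7" "cyc_gap n (2 * j + 12) i = 2 * p + 6"
      "cyc_skips n 1 i = q + 1"
proof -
  consider "i = 1" | "i = 2" | "i = 3" | "i = 4" | "i = 5" | "6 \<le> i" "i \<le> 2 * j + 11" | "i = 2 * j + 12" | "i = 2 * j + 13" | "i = 2 * j + 14" | "i = 2 * j + 15" | "i = 2 * j + 16" | "2 * j + 17 \<le> i" "i \<le> 4 * j + 21"
    using i unfolding n by force
  then show thesis
  proof cases
    case 1
    then have i_eq: "i = 1" .
    have g0: "cyc_gap n 1 i = 0" and g1: "cyc_gap n 6 i = 5" and g2: "cyc_gap n (2 * j + 12) i = 2 * j + 10"
      by (auto simp: cyc_gap_def gap_def cyc_off_def n i_eq)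
    moreover have "cyc_skips n 1 i = 0"
      by (rule cyc_skips_odd_n(1)) (use i_eq g0 in \<open>simp_all add: n\<close>)
    ultimately show thesis
      using that(1) i_eq g0 g1 g2 by blast
  next
    case 2
    then have i_eq: "i = 2" .
    have g0: "cyc_gap n 1 i = 1" and g1: "cyc_gap n 6 i = 4" and g2: "cyc_gap n (2 * j + 12) i = 2 * j + 10"
      by (auto simp: cyc_gap_def gap_def cyc_off_def n i_eq)
    moreover have "cyc_skips n 1 i = min (0 + 3) (2 * j + 10)"
      by (rule cyc_skips_odd_n(2)) (use i_eq g0 in \<open>simp_all add: n\<close>)
    ultimately show thesis
      using that(2) i_eq g0 g1 g2 by blast
  next
    case 3
    then have i_eq: "i = 3" .
    have g0: "cyc_gap n 1 i = 2" and g1: "cyc_gap n 6 i = 3" and g2: "cyc_gap n (2 * j + 12) i = 2 * j + 9"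
      by (auto simp: cyc_gap_def gap_def cyc_off_def n i_eq)
    moreover have "cyc_skips n 1 i = 1"
      by (rule cyc_skips_odd_n(1)) (use i_eq g0 in \<open>simp_all add: n\<close>)
    ultimately show thesis
      using that(3) i_eq g0 g1 g2 by blast
  next
    case 4
    then have i_eq: "i = 4" .
    have g0: "cyc_gap n 1 i = 3" and g1: "cyc_gap n 6 i = 2" and g2: "cyc_gap n (2 * j + 12) i = 2 * j + 8"
      by (auto simp: cyc_gap_def gap_def cyc_off_def n i_eq)
    moreover have "cyc_skips n 1 i = min (1 + 3) (2 * j + 9)"
      by (rule cyc_skips_odd_n(2)) (use i_eq g0 in \<open>simp_all add: n\<close>)
    ultimately show thesis
      using that(4) i_eq g0 g1 g2 by blast
  next
    case 5
    then have i_eq: "i = 5" .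
    have g0: "cyc_gap n 1 i = 4" and g1: "cyc_gap n 6 i = 1" and g2: "cyc_gap n (2 * j + 12) i = 2 * j + 7"
      by (auto simp: cyc_gap_def gap_def cyc_off_def n i_eq)
    moreover have "cyc_skips n 1 i = 2"
      by (rule cyc_skips_odd_n(1)) (use i_eq g0 in \<open>simp_all add: n\<close>)
    ultimately show thesis
      using that(5) i_eq g0 g1 g2 by blast
  next
    case 6
    have "\<exists>p. i = 2 * p + 6 \<or> i = 2 * p + 7"
      using 6(1) by presburger
    then obtain p where "i = 2 * p + 6 \<or> i = 2 * p + 7" by blast
    then show thesis
    proof
      assume i_eq: "i = 2 * p + 6"
      with 6(2) have "p \<le> j + 2" by simp
      then obtain q where q: "p + q = j + 2" using le_Suc_ex by metis
      have g0: "cyc_gap n 1 i = 2 * p + 5" and g1: "cyc_gap n 6 i = 2 * p" and g2: "cyc_gap n (2 * j + 12) i = 2 * q + 2"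
        using q by (auto simp: cyc_gap_def gap_def cyc_off_def n i_eq)
      moreover have "cyc_skips n 1 i = min (p + 2 + 3) (p + 2 * q + 4)"
        by (rule cyc_skips_odd_n(2)) (use q i_eq g0 in \<open>simp_all add: n\<close>)
      ultimately show thesis
        using that(6) q i_eq g0 g1 g2 by blast
    next
      assume i_eq: "i = 2 * p + 7"
      with 6(2) have "p \<le> j + 2" by simp
      then obtain q where q: "p + q = j + 2" using le_Suc_ex by metis
      have g0: "cyc_gap n 1 i = 2 * p + 6" and g1: "cyc_gap n 6 i = 2 * p + 1" and g2: "cyc_gap n (2 * j + 12) i = 2 * q + 1"
        using q by (auto simp: cyc_gap_def gap_def cyc_off_def n i_eq)
      moreover have "cyc_skips n 1 i = p + 3"
        by (rule cyc_skips_odd_n(1)) (use q i_eq g0 in \<open>simp_all add: n\<close>)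
      ultimately show thesis
        using that(7) q i_eq g0 g1 g2 by blast
    qed
  next
    case 7
    then have i_eq: "i = 2 * j + 12" .
    have g0: "cyc_gap n 1 i = 2 * j + 10" and g1: "cyc_gap n 6 i = 2 * j + 6" and g2: "cyc_gap n (2 * j + 12) i = 0"
      by (auto simp: cyc_gap_def gap_def cyc_off_def n i_eq)
    moreover have "cyc_skips n 1 i = j + 5"
      by (rule cyc_skips_odd_n(1)) (use i_eq g0 in \<open>simp_all add: n\<close>)
    ultimately show thesis
      using that(8) i_eq g0 g1 g2 by blast
  next
    case 8
    then have i_eq: "i = 2 * j + 13" .
    have g0: "cyc_gap n 1 i = 2 * j + 9" and g1: "cyc_gap n 6 i = 2 * j + 7" and g2: "cyc_gap n (2 * j + 12) i = 1"
      by (auto simp: cyc_gap_def gap_def cyc_off_def n i_eq)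
    moreover have "cyc_skips n 1 i = min (j + 4 + 3) (j + 6)"
      by (rule cyc_skips_odd_n(2)) (use i_eq g0 in \<open>simp_all add: n\<close>)
    ultimately show thesis
      using that(9) i_eq g0 g1 g2 by blast
  next
    case 9
    then have i_eq: "i = 2 * j + 14" .
    have g0: "cyc_gap n 1 i = 2 * j + 8" and g1: "cyc_gap n 6 i = 2 * j + 8" and g2: "cyc_gap n (2 * j + 12) i = 2"
      by (auto simp: cyc_gap_def gap_def cyc_off_def n i_eq)
    moreover have "cyc_skips n 1 i = j + 4"
      by (rule cyc_skips_odd_n(1)) (use i_eq g0 in \<open>simp_all add: n\<close>)
    ultimately show thesis
      using that(10) i_eq g0 g1 g2 by blast
  next
    case 10
    then have i_eq: "i = 2 * j + 15" .
    have g0: "cyc_gap n 1 i = 2 * j + 7" and g1: "cyc_gap n 6 i = 2 * j + 9" and g2: "cyc_gap n (2 * j + 12) i = 3"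
      by (auto simp: cyc_gap_def gap_def cyc_off_def n i_eq)
    moreover have "cyc_skips n 1 i = min (j + 3 + 3) (j + 7)"
      by (rule cyc_skips_odd_n(2)) (use i_eq g0 in \<open>simp_all add: n\<close>)
    ultimately show thesis
      using that(11) i_eq g0 g1 g2 by blast
  next
    case 11
    then have i_eq: "i = 2 * j + 16" .
    have g0: "cyc_gap n 1 i = 2 * j + 6" and g1: "cyc_gap n 6 i = 2 * j + 10" and g2: "cyc_gap n (2 * j + 12) i = 4"
      by (auto simp: cyc_gap_def gap_def cyc_off_def n i_eq)
    moreover have "cyc_skips n 1 i = j + 3"
      by (rule cyc_skips_odd_n(1)) (use i_eq g0 in \<open>simp_all add: n\<close>)
    ultimately show thesis
      using that(12) i_eq g0 g1 g2 by blast
  next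
    case 12
    have "\<exists>p. i = 2 * j + 2 * p + 17 \<or> i = 2 * j + 2 * p + 18"
      using 12(1) by presburger
    then obtain p where "i = 2 * j + 2 * p + 17 \<or> i = 2 * j + 2 * p + 18" by blast
    then show thesis
    proof
      assume i_eq: "i = 2 * j + 2 * p + 17"
      with 12(2) have "p \<le> j + 2" by simp
      then obtain q where q: "p + q = j + 2" using le_Suc_ex by metis
      have g0: "cyc_gap n 1 i = 2 * q + 1" and g1: "cyc_gap n 6 i = 2 * q + 6" and g2: "cyc_gap n (2 * j + 12) i = 2 * p + 5"
        using q by (auto simp: cyc_gap_def gap_def cyc_off_def n i_eq)
      moreover have "cyc_skips n 1 i = min (q + 3) (2 * p + q + 6)"
        by (rule cyc_skips_odd_n(2)) (use q i_eq g0 in \<open>simp_all add: n\<close>)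
      ultimately show thesis
        using that(13) q i_eq g0 g1 g2 by blast
    next
      assume i_eq: "i = 2 * j + 2 * p + 18"
      with 12(2) have "p \<le> j + 1" by simp
      then obtain q where q: "p + q = j + 1" using le_Suc_ex by metis
      have g0: "cyc_gap n 1 i = 2 * q + 2" and g1: "cyc_gap n 6 i = 2 * q + 7" and g2: "cyc_gap n (2 * j + 12) i = 2 * p + 6"
        using q by (auto simp: cyc_gap_def gap_def cyc_off_def n i_eq)
      moreover have "cyc_skips n 1 i = q + 1"
        by (rule cyc_skips_odd_n(1)) (use q i_eq g0 in \<open>simp_all add: n\<close>)
      ultimately show thesis
        using that(14) q i_eq g0 g1 g2 by blast
    qed
  qed
qed

text \<open>The antipodes of 1, 4 and \<open>2 * j + 7\<close> are \<open>2 * j + 8\<close>,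
  \<open>2 * j + 11\<close> and \<open>n\<close>. The three indices from 1 up to 4 and the three
  between the corresponding antipodes are listed singly.\<close>

lemma gap_cases_mod_2:
  fixes i j n :: nat
  assumes n: "n = 4 * j + 14" and i: "i \<in> {1..n}"
  obtains
    "i = 1"
      "cyc_gap n 1 i = 0" "cyc_gap n 4 i = 3" "cyc_gap n (2 * j + 7) i = 2 * j + 6"
      "cyc_skips n 1 i = 0" "cyc_skips n 4 i = 1 + 3" "cyc_skips n (2 * j + 7) i = j + 3"
  | "i = 2"
      "cyc_gap n 1 i = 1" "cyc_gap n 4 i = 2" "cyc_gap n (2 * j + 7) i = 2 * j + 5"
      "cyc_skips n 1 i = 0 + 3" "cyc_skips n 4 i = 1" "cyc_skips n (2 * j + 7) i = j + 2 + 3"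
  | "i = 3"
      "cyc_gap n 1 i = 2" "cyc_gap n 4 i = 1" "cyc_gap n (2 * j + 7) i = 2 * j + 4"
      "cyc_skips n 1 i = 1" "cyc_skips n 4 i = 0 + 3" "cyc_skips n (2 * j + 7) i = j + 2"
  | p q where "p + q = j + 1" "i = 2 * p + 5"
      "cyc_gap n 1 i = 2 * p + 4" "cyc_gap n 4 i = 2 * p + 1" "cyc_gap n (2 * j + 7) i = 2 * q"
      "cyc_skips n 1 i = p + 2" "cyc_skips n 4 i = p + 3" "cyc_skips n (2 * j + 7) i = q"
  | p q where "p + q = j + 1" "i = 2 * p + 4"
      "cyc_gap n 1 i = 2 * p + 3" "cyc_gap n 4 i = 2 * p" "cyc_gap n (2 * j + 7) i = 2 * q + 1"
      "cyc_skips n 1 i = p + 1 + 3" "cyc_skips n 4 i = p" "cyc_skips n (2 * j + 7) i = q + 3"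
  | "i = 2 * j + 8"
      "cyc_gap n 1 i = 2 * j + 7" "cyc_gap n 4 i = 2 * j + 4" "cyc_gap n (2 * j + 7) i = 1"
      "cyc_skips n 1 i = j + 3 + 3" "cyc_skips n 4 i = j + 2" "cyc_skips n (2 * j + 7) i = 0 + 3"
  | "i = 2 * j + 9"
      "cyc_gap n 1 i = 2 * j + 6" "cyc_gap n 4 i = 2 * j + 5" "cyc_gap n (2 * j + 7) i = 2"
      "cyc_skips n 1 i = j + 3" "cyc_skips n 4 i = j + 2 + 3" "cyc_skips n (2 * j + 7) i = 1"
  | "i = 2 * j + 10"
      "cyc_gap n 1 i = 2 * j + 5" "cyc_gap n 4 i = 2 * j + 6" "cyc_gap n (2 * j + 7) i = 3"
      "cyc_skips n 1 i = j + 2 + 3" "cyc_skips n 4 i = j + 3" "cyc_skips n (2 * j + 7) i = 1 + 3"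
  | p q where "p + q = j + 1" "i = 2 * j + 2 * p + 12"
      "cyc_gap n 1 i = 2 * q + 1" "cyc_gap n 4 i = 2 * q + 4" "cyc_gap n (2 * j + 7) i = 2 * p + 5"
      "cyc_skips n 1 i = q + 3" "cyc_skips n 4 i = q + 2" "cyc_skips n (2 * j + 7) i = p + 2 + 3"
  | p q where "p + q = j + 1" "i = 2 * j + 2 * p + 11"
      "cyc_gap n 1 i = 2 * q + 2" "cyc_gap n 4 i = 2 * q + 5" "cyc_gap n (2 * j + 7) i = 2 * p + 4"
      "cyc_skips n 1 i = q + 1" "cyc_skips n 4 i = q + 2 + 3" "cyc_skips n (2 * j + 7) i = p + 2"
proof -
  consider "i = 1" | "i = 2" | "i = 3" | "4 \<le> i" "i \<le> 2 * j + 7" | "i = 2 * j + 8" | "i = 2 * j + 9" | "i = 2 * j + 10" | "2 * j + 11 \<le> i" "i \<le> 4 * j + 14"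
    using i unfolding n by force
  then show thesis
  proof cases
    case 1
    then have i_eq: "i = 1" .
    have g0: "cyc_gap n 1 i = 0" and g1: "cyc_gap n 4 i = 3" and g2: "cyc_gap n (2 * j + 7) i = 2 * j + 6"
      by (auto simp: cyc_gap_def gap_def cyc_off_def n i_eq)
    moreover have "cyc_skips n 1 i = 0"
      by (rule cyc_skips_even_n(1)) (use i_eq g0 in \<open>simp_all add: n\<close>)
    moreover have "cyc_skips n 4 i = 1 + 3"
      by (rule cyc_skips_even_n(2)) (use i_eq g1 in \<open>simp_all add: n\<close>)
    moreover have "cyc_skips n (2 * j + 7) i = j + 3"
      by (rule cyc_skips_even_n(1)) (use i_eq g2 in \<open>simp_all add: n\<close>)
    ultimately show thesis
      using that(1) i_eq g0 g1 g2 by blast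
  next
    case 2
    then have i_eq: "i = 2" .
    have g0: "cyc_gap n 1 i = 1" and g1: "cyc_gap n 4 i = 2" and g2: "cyc_gap n (2 * j + 7) i = 2 * j + 5"
      by (auto simp: cyc_gap_def gap_def cyc_off_def n i_eq)
    moreover have "cyc_skips n 1 i = 0 + 3"
      by (rule cyc_skips_even_n(2)) (use i_eq g0 in \<open>simp_all add: n\<close>)
    moreover have "cyc_skips n 4 i = 1"
      by (rule cyc_skips_even_n(1)) (use i_eq g1 in \<open>simp_all add: n\<close>)
    moreover have "cyc_skips n (2 * j + 7) i = j + 2 + 3"
      by (rule cyc_skips_even_n(2)) (use i_eq g2 in \<open>simp_all add: n\<close>)
    ultimately show thesis
      using that(2) i_eq g0 g1 g2 by blast
  next
    case 3
    then have i_eq: "i = 3" .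
    have g0: "cyc_gap n 1 i = 2" and g1: "cyc_gap n 4 i = 1" and g2: "cyc_gap n (2 * j + 7) i = 2 * j + 4"
      by (auto simp: cyc_gap_def gap_def cyc_off_def n i_eq)
    moreover have "cyc_skips n 1 i = 1"
      by (rule cyc_skips_even_n(1)) (use i_eq g0 in \<open>simp_all add: n\<close>)
    moreover have "cyc_skips n 4 i = 0 + 3"
      by (rule cyc_skips_even_n(2)) (use i_eq g1 in \<open>simp_all add: n\<close>)
    moreover have "cyc_skips n (2 * j + 7) i = j + 2"
      by (rule cyc_skips_even_n(1)) (use i_eq g2 in \<open>simp_all add: n\<close>)
    ultimately show thesis
      using that(3) i_eq g0 g1 g2 by blast
  next
    case 4
    have "\<exists>p. i = 2 * p + 4 \<or> i = 2 * p + 5"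
      using 4(1) by presburger
    then obtain p where "i = 2 * p + 4 \<or> i = 2 * p + 5" by blast
    then show thesis
    proof
      assume i_eq: "i = 2 * p + 4"
      with 4(2) have "p \<le> j + 1" by simp
      then obtain q where q: "p + q = j + 1" using le_Suc_ex by metis
      have g0: "cyc_gap n 1 i = 2 * p + 3" and g1: "cyc_gap n 4 i = 2 * p" and g2: "cyc_gap n (2 * j + 7) i = 2 * q + 1"
        using q by (auto simp: cyc_gap_def gap_def cyc_off_def n i_eq)
      moreover have "cyc_skips n 1 i = p + 1 + 3"
        by (rule cyc_skips_even_n(2)) (use q i_eq g0 in \<open>simp_all add: n\<close>)
      moreover have "cyc_skips n 4 i = p"
        by (rule cyc_skips_even_n(1)) (use q i_eq g1 in \<open>simp_all add: n\<close>)
      moreover have "cyc_skips n (2 * j + 7) i = q + 3"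
        by (rule cyc_skips_even_n(2)) (use q i_eq g2 in \<open>simp_all add: n\<close>)
      ultimately show thesis
        using that(5) q i_eq g0 g1 g2 by blast
    next
      assume i_eq: "i = 2 * p + 5"
      with 4(2) have "p \<le> j + 1" by simp
      then obtain q where q: "p + q = j + 1" using le_Suc_ex by metis
      have g0: "cyc_gap n 1 i = 2 * p + 4" and g1: "cyc_gap n 4 i = 2 * p + 1" and g2: "cyc_gap n (2 * j + 7) i = 2 * q"
        using q by (auto simp: cyc_gap_def gap_def cyc_off_def n i_eq)
      moreover have "cyc_skips n 1 i = p + 2"
        by (rule cyc_skips_even_n(1)) (use q i_eq g0 in \<open>simp_all add: n\<close>)
      moreover have "cyc_skips n 4 i = p + 3"
        by (rule cyc_skips_even_n(2)) (use q i_eq g1 in \<open>simp_all add: n\<close>)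
      moreover have "cyc_skips n (2 * j + 7) i = q"
        by (rule cyc_skips_even_n(1)) (use q i_eq g2 in \<open>simp_all add: n\<close>)
      ultimately show thesis
        using that(4) q i_eq g0 g1 g2 by blast
    qed
  next
    case 5
    then have i_eq: "i = 2 * j + 8" .
    have g0: "cyc_gap n 1 i = 2 * j + 7" and g1: "cyc_gap n 4 i = 2 * j + 4" and g2: "cyc_gap n (2 * j + 7) i = 1"
      by (auto simp: cyc_gap_def gap_def cyc_off_def n i_eq)
    moreover have "cyc_skips n 1 i = j + 3 + 3"
      by (rule cyc_skips_even_n(2)) (use i_eq g0 in \<open>simp_all add: n\<close>)
    moreover have "cyc_skips n 4 i = j + 2"
      by (rule cyc_skips_even_n(1)) (use i_eq g1 in \<open>simp_all add: n\<close>)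
    moreover have "cyc_skips n (2 * j + 7) i = 0 + 3"
      by (rule cyc_skips_even_n(2)) (use i_eq g2 in \<open>simp_all add: n\<close>)
    ultimately show thesis
      using that(6) i_eq g0 g1 g2 by blast
  next
    case 6
    then have i_eq: "i = 2 * j + 9" .
    have g0: "cyc_gap n 1 i = 2 * j + 6" and g1: "cyc_gap n 4 i = 2 * j + 5" and g2: "cyc_gap n (2 * j + 7) i = 2"
      by (auto simp: cyc_gap_def gap_def cyc_off_def n i_eq)
    moreover have "cyc_skips n 1 i = j + 3"
      by (rule cyc_skips_even_n(1)) (use i_eq g0 in \<open>simp_all add: n\<close>)
    moreover have "cyc_skips n 4 i = j + 2 + 3"
      by (rule cyc_skips_even_n(2)) (use i_eq g1 in \<open>simp_all add: n\<close>)
    moreover have "cyc_skips n (2 * j + 7) i = 1"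
      by (rule cyc_skips_even_n(1)) (use i_eq g2 in \<open>simp_all add: n\<close>)
    ultimately show thesis
      using that(7) i_eq g0 g1 g2 by blast
  next
    case 7
    then have i_eq: "i = 2 * j + 10" .
    have g0: "cyc_gap n 1 i = 2 * j + 5" and g1: "cyc_gap n 4 i = 2 * j + 6" and g2: "cyc_gap n (2 * j + 7) i = 3"
      by (auto simp: cyc_gap_def gap_def cyc_off_def n i_eq)
    moreover have "cyc_skips n 1 i = j + 2 + 3"
      by (rule cyc_skips_even_n(2)) (use i_eq g0 in \<open>simp_all add: n\<close>)
    moreover have "cyc_skips n 4 i = j + 3"
      by (rule cyc_skips_even_n(1)) (use i_eq g1 in \<open>simp_all add: n\<close>)
    moreover have "cyc_skips n (2 * j + 7) i = 1 + 3"
      by (rule cyc_skips_even_n(2)) (use i_eq g2 in \<open>simp_all add: n\<close>)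
    ultimately show thesis
      using that(8) i_eq g0 g1 g2 by blast
  next
    case 8
    have "\<exists>p. i = 2 * j + 2 * p + 11 \<or> i = 2 * j + 2 * p + 12"
      using 8(1) by presburger
    then obtain p where "i = 2 * j + 2 * p + 11 \<or> i = 2 * j + 2 * p + 12" by blast
    then show thesis
    proof
      assume i_eq: "i = 2 * j + 2 * p + 11"
      with 8(2) have "p \<le> j + 1" by simp
      then obtain q where q: "p + q = j + 1" using le_Suc_ex by metis
      have g0: "cyc_gap n 1 i = 2 * q + 2" and g1: "cyc_gap n 4 i = 2 * q + 5" and g2: "cyc_gap n (2 * j + 7) i = 2 * p + 4"
        using q by (auto simp: cyc_gap_def gap_def cyc_off_def n i_eq)
      moreover have "cyc_skips n 1 i = q + 1"
        by (rule cyc_skips_even_n(1)) (use q i_eq g0 in \<open>simp_all add: n\<close>)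
      moreover have "cyc_skips n 4 i = q + 2 + 3"
        by (rule cyc_skips_even_n(2)) (use q i_eq g1 in \<open>simp_all add: n\<close>)
      moreover have "cyc_skips n (2 * j + 7) i = p + 2"
        by (rule cyc_skips_even_n(1)) (use q i_eq g2 in \<open>simp_all add: n\<close>)
      ultimately show thesis
        using that(10) q i_eq g0 g1 g2 by blast
    next
      assume i_eq: "i = 2 * j + 2 * p + 12"
      with 8(2) have "p \<le> j + 1" by simp
      then obtain q where q: "p + q = j + 1" using le_Suc_ex by metis
      have g0: "cyc_gap n 1 i = 2 * q + 1" and g1: "cyc_gap n 4 i = 2 * q + 4" and g2: "cyc_gap n (2 * j + 7) i = 2 * p + 5"
        using q by (auto simp: cyc_gap_def gap_def cyc_off_def n i_eq)
      moreover have "cyc_skips n 1 i = q + 3"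
        by (rule cyc_skips_even_n(2)) (use q i_eq g0 in \<open>simp_all add: n\<close>)
      moreover have "cyc_skips n 4 i = q + 2"
        by (rule cyc_skips_even_n(1)) (use q i_eq g1 in \<open>simp_all add: n\<close>)
      moreover have "cyc_skips n (2 * j + 7) i = p + 2 + 3"
        by (rule cyc_skips_even_n(2)) (use q i_eq g2 in \<open>simp_all add: n\<close>)
      ultimately show thesis
        using that(9) q i_eq g0 g1 g2 by blast
    qed
  qed
qed

text \<open>As \<open>n\<close> is odd, every index has two antipodes; \<open>2 * j + 5\<close> is
  an antipode of both 1 and 2 and forms a piece of its own.\<close>

lemma gap_cases_mod_3:
  fixes i j n :: nat
  assumes n: "n = 4 * j + 7" and i: "i \<in> {1..n}"
  obtains
    "i = 1"
      "cyc_gap n 1 i = 0" "cyc_gap n 2 i = 1" "cyc_gap n (2 * j + 4) i = 2 * j + 3"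
      "cyc_skips n 1 i = 0" "cyc_skips n 2 i = min (0 + 3) (2 * j + 3)"
  | p q where "p + q = j" "i = 2 * p + 3"
      "cyc_gap n 1 i = 2 * p + 2" "cyc_gap n 2 i = 2 * p + 1" "cyc_gap n (2 * j + 4) i = 2 * q + 1"
      "cyc_skips n 1 i = p + 1" "cyc_skips n 2 i = min (p + 3) (p + 2 * q + 3)"
  | p q where "p + q = j + 1" "i = 2 * p + 2"
      "cyc_gap n 1 i = 2 * p + 1" "cyc_gap n 2 i = 2 * p" "cyc_gap n (2 * j + 4) i = 2 * q"
      "cyc_skips n 1 i = min (p + 3) (p + 2 * q + 1)" "cyc_skips n 2 i = p"
  | "i = 2 * j + 5"
      "cyc_gap n 1 i = 2 * j + 3" "cyc_gap n 2 i = 2 * j + 3" "cyc_gap n (2 * j + 4) i = 1"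
      "cyc_skips n 1 i = min (j + 1 + 3) (j + 2)" "cyc_skips n 2 i = min (j + 1 + 3) (j + 2)"
  | p q where "p + q = j" "i = 2 * j + 2 * p + 7"
      "cyc_gap n 1 i = 2 * q + 1" "cyc_gap n 2 i = 2 * q + 2" "cyc_gap n (2 * j + 4) i = 2 * p + 3"
      "cyc_skips n 1 i = min (q + 3) (2 * p + q + 3)" "cyc_skips n 2 i = q + 1"
  | p q where "p + q = j" "i = 2 * j + 2 * p + 6"
      "cyc_gap n 1 i = 2 * q + 2" "cyc_gap n 2 i = 2 * q + 3" "cyc_gap n (2 * j + 4) i = 2 * p + 2"
      "cyc_skips n 1 i = q + 1" "cyc_skips n 2 i = min (q + 1 + 3) (2 * p + q + 2)"
proof -
  consider "i = 1" | "2 \<le> i" "i \<le> 2 * j + 4" | "i = 2 * j + 5" | "2 * j + 6 \<le> i" "i \<le> 4 * j + 7"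
    using i unfolding n by force
  then show thesis
  proof cases
    case 1
    then have i_eq: "i = 1" .
    have g0: "cyc_gap n 1 i = 0" and g1: "cyc_gap n 2 i = 1" and g2: "cyc_gap n (2 * j + 4) i = 2 * j + 3"
      by (auto simp: cyc_gap_def gap_def cyc_off_def n i_eq)
    moreover have "cyc_skips n 1 i = 0"
      by (rule cyc_skips_odd_n(1)) (use i_eq g0 in \<open>simp_all add: n\<close>)
    moreover have "cyc_skips n 2 i = min (0 + 3) (2 * j + 3)"
      by (rule cyc_skips_odd_n(2)) (use i_eq g1 in \<open>simp_all add: n\<close>)
    ultimately show thesis
      using that(1) i_eq g0 g1 g2 by blast
  next
    case 2
    have "\<exists>p. i = 2 * p + 2 \<or> i = 2 * p + 3"
      using 2(1) by presburger
    then obtain p where "i = 2 * p + 2 \<or> i = 2 * p + 3" by blast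
    then show thesis
    proof
      assume i_eq: "i = 2 * p + 2"
      with 2(2) have "p \<le> j + 1" by simp
      then obtain q where q: "p + q = j + 1" using le_Suc_ex by metis
      have g0: "cyc_gap n 1 i = 2 * p + 1" and g1: "cyc_gap n 2 i = 2 * p" and g2: "cyc_gap n (2 * j + 4) i = 2 * q"
        using q by (auto simp: cyc_gap_def gap_def cyc_off_def n i_eq)
      moreover have "cyc_skips n 1 i = min (p + 3) (p + 2 * q + 1)"
        by (rule cyc_skips_odd_n(2)) (use q i_eq g0 in \<open>simp_all add: n\<close>)
      moreover have "cyc_skips n 2 i = p"
        by (rule cyc_skips_odd_n(1)) (use q i_eq g1 in \<open>simp_all add: n\<close>)
      ultimately show thesis
        using that(3) q i_eq g0 g1 g2 by blast
    next
      assume i_eq: "i = 2 * p + 3"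
      with 2(2) have "p \<le> j" by simp
      then obtain q where q: "p + q = j" using le_Suc_ex by metis
      have g0: "cyc_gap n 1 i = 2 * p + 2" and g1: "cyc_gap n 2 i = 2 * p + 1" and g2: "cyc_gap n (2 * j + 4) i = 2 * q + 1"
        using q by (auto simp: cyc_gap_def gap_def cyc_off_def n i_eq)
      moreover have "cyc_skips n 1 i = p + 1"
        by (rule cyc_skips_odd_n(1)) (use q i_eq g0 in \<open>simp_all add: n\<close>)
      moreover have "cyc_skips n 2 i = min (p + 3) (p + 2 * q + 3)"
        by (rule cyc_skips_odd_n(2)) (use q i_eq g1 in \<open>simp_all add: n\<close>)
      ultimately show thesis
        using that(2) q i_eq g0 g1 g2 by blast
    qed
  next
    case 3
    then have i_eq: "i = 2 * j + 5" .
    have g0: "cyc_gap n 1 i = 2 * j + 3" and g1: "cyc_gap n 2 i = 2 * j + 3" and g2: "cyc_gap n (2 * j + 4) i = 1"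
      by (auto simp: cyc_gap_def gap_def cyc_off_def n i_eq)
    moreover have "cyc_skips n 1 i = min (j + 1 + 3) (j + 2)"
      by (rule cyc_skips_odd_n(2)) (use i_eq g0 in \<open>simp_all add: n\<close>)
    moreover have "cyc_skips n 2 i = min (j + 1 + 3) (j + 2)"
      by (rule cyc_skips_odd_n(2)) (use i_eq g1 in \<open>simp_all add: n\<close>)
    ultimately show thesis
      using that(4) i_eq g0 g1 g2 by blast
  next
    case 4
    have "\<exists>p. i = 2 * j + 2 * p + 6 \<or> i = 2 * j + 2 * p + 7"
      using 4(1) by presburger
    then obtain p where "i = 2 * j + 2 * p + 6 \<or> i = 2 * j + 2 * p + 7" by blast
    then show thesis
    proof
      assume i_eq: "i = 2 * j + 2 * p + 6"
      with 4(2) have "p \<le> j" by simp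
      then obtain q where q: "p + q = j" using le_Suc_ex by metis
      have g0: "cyc_gap n 1 i = 2 * q + 2" and g1: "cyc_gap n 2 i = 2 * q + 3" and g2: "cyc_gap n (2 * j + 4) i = 2 * p + 2"
        using q by (auto simp: cyc_gap_def gap_def cyc_off_def n i_eq)
      moreover have "cyc_skips n 1 i = q + 1"
        by (rule cyc_skips_odd_n(1)) (use q i_eq g0 in \<open>simp_all add: n\<close>)
      moreover have "cyc_skips n 2 i = min (q + 1 + 3) (2 * p + q + 2)"
        by (rule cyc_skips_odd_n(2)) (use q i_eq g1 in \<open>simp_all add: n\<close>)
      ultimately show thesis
        using that(6) q i_eq g0 g1 g2 by blast
    next
      assume i_eq: "i = 2 * j + 2 * p + 7"
      with 4(2) have "p \<le> j" by simp
      then obtain q where q: "p + q = j" using le_Suc_ex by metis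
      have g0: "cyc_gap n 1 i = 2 * q + 1" and g1: "cyc_gap n 2 i = 2 * q + 2" and g2: "cyc_gap n (2 * j + 4) i = 2 * p + 3"
        using q by (auto simp: cyc_gap_def gap_def cyc_off_def n i_eq)
      moreover have "cyc_skips n 1 i = min (q + 3) (2 * p + q + 3)"
        by (rule cyc_skips_odd_n(2)) (use q i_eq g0 in \<open>simp_all add: n\<close>)
      moreover have "cyc_skips n 2 i = q + 1"
        by (rule cyc_skips_odd_n(1)) (use q i_eq g1 in \<open>simp_all add: n\<close>)
      ultimately show thesis
        using that(5) q i_eq g0 g1 g2 by blast
    qed
  qed
qed

section \<open>Three landmarks suffice\<close>

text \<open>Two distinct vertices may be assumed to have \<open>vertex_code v < vertex_code w\<close>: this replaces the
  disequality of vertices by a single linear inequality for arithmetic.\<close>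

primrec vertex_code :: "prism_vertex \<Rightarrow> nat" where
 "vertex_code (A i) = 3 * i" | "vertex_code (B i) = 3 * i + 1" | "vertex_code (C i) = 3 * i + 2"

lemma vertex_code_inj: "vertex_code v = vertex_code w \<Longrightarrow> v = w"
  by (cases v; cases w; simp; presburger)

text \<open>Each piece is evaluated in its three layers. The vertex enters only through its code, so
  that comparing two vertices is pure linear arithmetic.\<close>

lemma pdist_cases_mod_0:
  assumes n: "n = 4 * j + 8" and v: "v \<in> pverts (P2_prism n)"
  obtains
    "vertex_code v = 3"
      "pdist n (A 1) v = 0" "pdist n (A 2) v = 3" "pdist n (A (2 * j + 5)) v = j + 2"
  | "vertex_code v = 4"
      "pdist n (A 1) v = 1" "pdist n (A 2) v = 2" "pdist n (A (2 * j + 5)) v = j + 3"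
  | "vertex_code v = 5"
      "pdist n (A 1) v = 2" "pdist n (A 2) v = 3" "pdist n (A (2 * j + 5)) v = j + 4"
  | p q where "p + q = j + 1" "vertex_code v = 6 * p + 9"
      "pdist n (A 1) v = p + 1" "pdist n (A 2) v = p + 3" "pdist n (A (2 * j + 5)) v = q"
  | p q where "p + q = j + 1" "vertex_code v = 6 * p + 10"
      "pdist n (A 1) v = p + 2" "pdist n (A 2) v = p + 2" "pdist n (A (2 * j + 5)) v = q + 1"
  | p q where "p + q = j + 1" "vertex_code v = 6 * p + 11"
      "pdist n (A 1) v = p + 3" "pdist n (A 2) v = p + 3" "pdist n (A (2 * j + 5)) v = q + 2"
  | p q where "p + q = j + 1" "vertex_code v = 6 * p + 6"
      "pdist n (A 1) v = p + 3" "pdist n (A 2) v = p" "pdist n (A (2 * j + 5)) v = q + 3"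
  | p q where "p + q = j + 1" "vertex_code v = 6 * p + 7"
      "pdist n (A 1) v = p + 2" "pdist n (A 2) v = p + 1" "pdist n (A (2 * j + 5)) v = q + 2"
  | p q where "p + q = j + 1" "vertex_code v = 6 * p + 8"
      "pdist n (A 1) v = p + 3" "pdist n (A 2) v = p + 2" "pdist n (A (2 * j + 5)) v = q + 3"
  | p q where "p + q = j" "vertex_code v = 6 * j + 6 * p + 21"
      "pdist n (A 1) v = q + 1" "pdist n (A 2) v = q + 4" "pdist n (A (2 * j + 5)) v = p + 1"
  | p q where "p + q = j" "vertex_code v = 6 * j + 6 * p + 22"
      "pdist n (A 1) v = q + 2" "pdist n (A 2) v = q + 3" "pdist n (A (2 * j + 5)) v = p + 2"
  | p q where "p + q = j" "vertex_code v = 6 * j + 6 * p + 23"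
      "pdist n (A 1) v = q + 3" "pdist n (A 2) v = q + 4" "pdist n (A (2 * j + 5)) v = p + 3"
  | p q where "p + q = j + 1" "vertex_code v = 6 * j + 6 * p + 18"
      "pdist n (A 1) v = q + 3" "pdist n (A 2) v = q + 1" "pdist n (A (2 * j + 5)) v = p + 3"
  | p q where "p + q = j + 1" "vertex_code v = 6 * j + 6 * p + 19"
      "pdist n (A 1) v = q + 2" "pdist n (A 2) v = q + 2" "pdist n (A (2 * j + 5)) v = p + 2"
  | p q where "p + q = j + 1" "vertex_code v = 6 * j + 6 * p + 20"
      "pdist n (A 1) v = q + 3" "pdist n (A 2) v = q + 3" "pdist n (A (2 * j + 5)) v = p + 3"
proof (cases rule: gap_cases_mod_0[OF n index_in[OF v]])
  case 1
  then show thesis using that(1) that(2) that(3)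
    by (cases v) (simp_all add: pdist_simps hops_def)
next
  case (2 p q)
  then show thesis using that(4)[of p q] that(5)[of p q] that(6)[of p q]
    by (cases v) (simp_all add: pdist_simps hops_def)
next
  case (3 p q)
  then show thesis using that(7)[of p q] that(8)[of p q] that(9)[of p q]
    by (cases v) (simp_all add: pdist_simps hops_def)
next
  case (4 p q)
  then show thesis using that(10)[of p q] that(11)[of p q] that(12)[of p q]
    by (cases v) (simp_all add: pdist_simps hops_def)
next
  case (5 p q)
  then show thesis using that(13)[of p q] that(14)[of p q] that(15)[of p q]
    by (cases v) (simp_all add: pdist_simps hops_def)
qed

text \<open>On the two long arcs the distance to \<open>A 1\<close> minus that to
  \<open>A 2\<close>, together with the sum of the distances to \<open>A 1\<close> and
  \<open>A (2 * j + 5)\<close>, takes a different constant value on each of the twelve classes given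
  by layer, parity and arc. Within a class the distance to \<open>A 1\<close> fixes the index. The
  vertices of index 1 extend the classes of odd index on the far arc by one more value.\<close>

lemma pdist_inj_mod_0:
  assumes n: "n = 4 * j + 8" and v: "v \<in> pverts (P2_prism n)" and w: "w \<in> pverts (P2_prism n)"
    and eq: "pdist n (A 1) v = pdist n (A 1) w"
    "pdist n (A 2) v = pdist n (A 2) w"
    "pdist n (A (2 * j + 5)) v = pdist n (A (2 * j + 5)) w"
  shows "v = w"
proof -
  have False if "vertex_code x < vertex_code y" "x \<in> pverts (P2_prism n)" "y \<in> pverts (P2_prism n)"
    "pdist n (A 1) x = pdist n (A 1) y" "pdist n (A 2) x = pdist n (A 2) y"
    "pdist n (A (2 * j + 5)) x = pdist n (A (2 * j + 5)) y" for x y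
    using that(1,4-6)
    \<comment> \<open>Every pair of table rows gives a linear system in \<open>j\<close> and the two
      pairs \<open>p\<close>, \<open>q\<close>; for two vertices of one class the strict inequality
      of codes yields the contradiction.\<close>
    by - (rule pdist_cases_mod_0[OF n that(2)]; (rule pdist_cases_mod_0[OF n that(3)]; (linarith | simp, presburger)))
  from this[of v w] this[of w v] show ?thesis using assms by (metis vertex_code_inj nat_neq_iff)
qed

lemma pdist_cases_mod_1:
  assumes n: "n = 4 * j + 21" and v: "v \<in> pverts (P2_prism n)"
  obtains
    "vertex_code v = 3"
      "pdist n (A 1) v = 0" "pdist n (B 6) v = 4" "pdist n (B (2 * j + 12)) v = j + 6"
  | "vertex_code v = 4"
      "pdist n (A 1) v = 1" "pdist n (B 6) v = 5" "pdist n (B (2 * j + 12)) v = j + 7"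
  | "vertex_code v = 5"
      "pdist n (A 1) v = 2" "pdist n (B 6) v = 6" "pdist n (B (2 * j + 12)) v = j + 8"
  | "vertex_code v = 6"
      "pdist n (A 1) v = 3" "pdist n (B 6) v = 3" "pdist n (B (2 * j + 12)) v = j + 6"
  | "vertex_code v = 7"
      "pdist n (A 1) v = 2" "pdist n (B 6) v = 4" "pdist n (B (2 * j + 12)) v = j + 7"
  | "vertex_code v = 8"
      "pdist n (A 1) v = 3" "pdist n (B 6) v = 5" "pdist n (B (2 * j + 12)) v = j + 8"
  | "vertex_code v = 9"
      "pdist n (A 1) v = 1" "pdist n (B 6) v = 3" "pdist n (B (2 * j + 12)) v = j + 6"
  | "vertex_code v = 10"
      "pdist n (A 1) v = 2" "pdist n (B 6) v = 3" "pdist n (B (2 * j + 12)) v = j + 7"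
  | "vertex_code v = 11"
      "pdist n (A 1) v = 3" "pdist n (B 6) v = 4" "pdist n (B (2 * j + 12)) v = j + 8"
  | "vertex_code v = 12"
      "pdist n (A 1) v = 4" "pdist n (B 6) v = 2" "pdist n (B (2 * j + 12)) v = j + 5"
  | "vertex_code v = 13"
      "pdist n (A 1) v = 3" "pdist n (B 6) v = 2" "pdist n (B (2 * j + 12)) v = j + 6"
  | "vertex_code v = 14"
      "pdist n (A 1) v = 4" "pdist n (B 6) v = 3" "pdist n (B (2 * j + 12)) v = j + 7"
  | "vertex_code v = 15"
      "pdist n (A 1) v = 2" "pdist n (B 6) v = 2" "pdist n (B (2 * j + 12)) v = j + 5"
  | "vertex_code v = 16"
      "pdist n (A 1) v = 3" "pdist n (B 6) v = 1" "pdist n (B (2 * j + 12)) v = j + 6"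
  | "vertex_code v = 17"
      "pdist n (A 1) v = 4" "pdist n (B 6) v = 2" "pdist n (B (2 * j + 12)) v = j + 7"
  | "vertex_code v = 18"
      "pdist n (A 1) v = 5" "pdist n (B 6) v = 1" "pdist n (B (2 * j + 12)) v = j + 4"
  | "vertex_code v = 19"
      "pdist n (A 1) v = 4" "pdist n (B 6) v = 0" "pdist n (B (2 * j + 12)) v = j + 5"
  | "vertex_code v = 20"
      "pdist n (A 1) v = 5" "pdist n (B 6) v = 1" "pdist n (B (2 * j + 12)) v = j + 6"
  | "vertex_code v = 24"
      "pdist n (A 1) v = 6" "pdist n (B 6) v = 2" "pdist n (B (2 * j + 12)) v = j + 3"
  | "vertex_code v = 25"
      "pdist n (A 1) v = 5" "pdist n (B 6) v = 2" "pdist n (B (2 * j + 12)) v = j + 4"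
  | "vertex_code v = 26"
      "pdist n (A 1) v = 6" "pdist n (B 6) v = 3" "pdist n (B (2 * j + 12)) v = j + 5"
  | "vertex_code v = 6 * j + 30"
      "pdist n (A 1) v = j + 6" "pdist n (B 6) v = j + 3" "pdist n (B (2 * j + 12)) v = 2"
  | "vertex_code v = 6 * j + 31"
      "pdist n (A 1) v = j + 6" "pdist n (B 6) v = j + 4" "pdist n (B (2 * j + 12)) v = 2"
  | "vertex_code v = 6 * j + 32"
      "pdist n (A 1) v = j + 7" "pdist n (B 6) v = j + 5" "pdist n (B (2 * j + 12)) v = 3"
  | p q where "p + q + 1 = j" "vertex_code v = 6 * p + 30"
      "pdist n (A 1) v = p + 7" "pdist n (B 6) v = p + 3" "pdist n (B (2 * j + 12)) v = q + 3"
  | p q where "p + q + 1 = j" "vertex_code v = 6 * p + 31"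
      "pdist n (A 1) v = p + 6" "pdist n (B 6) v = p + 4" "pdist n (B (2 * j + 12)) v = q + 4"
  | p q where "p + q + 1 = j" "vertex_code v = 6 * p + 32"
      "pdist n (A 1) v = p + 7" "pdist n (B 6) v = p + 5" "pdist n (B (2 * j + 12)) v = q + 5"
  | "vertex_code v = 21"
      "pdist n (A 1) v = 3" "pdist n (B 6) v = 2" "pdist n (B (2 * j + 12)) v = j + 4"
  | "vertex_code v = 22"
      "pdist n (A 1) v = 4" "pdist n (B 6) v = 1" "pdist n (B (2 * j + 12)) v = j + 5"
  | "vertex_code v = 23"
      "pdist n (A 1) v = 5" "pdist n (B 6) v = 2" "pdist n (B (2 * j + 12)) v = j + 6"
  | "vertex_code v = 27"
      "pdist n (A 1) v = 4" "pdist n (B 6) v = 3" "pdist n (B (2 * j + 12)) v = j + 3"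
  | "vertex_code v = 28"
      "pdist n (A 1) v = 5" "pdist n (B 6) v = 3" "pdist n (B (2 * j + 12)) v = min (2 * j + 3) (j + 4)"
  | "vertex_code v = 29"
      "pdist n (A 1) v = 6" "pdist n (B 6) v = 4" "pdist n (B (2 * j + 12)) v = min (2 * j + 4) (j + 5)"
  | "vertex_code v = 6 * j + 33"
      "pdist n (A 1) v = j + 5" "pdist n (B 6) v = j + 4" "pdist n (B (2 * j + 12)) v = 2"
  | "vertex_code v = 6 * j + 34"
      "pdist n (A 1) v = j + 6" "pdist n (B 6) v = j + 5" "pdist n (B (2 * j + 12)) v = 1"
  | "vertex_code v = 6 * j + 35"
      "pdist n (A 1) v = j + 7" "pdist n (B 6) v = j + 6" "pdist n (B (2 * j + 12)) v = 2"
  | "vertex_code v = 6 * j + 27"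
      "pdist n (A 1) v = j + 4" "pdist n (B 6) v = j + 3" "pdist n (B (2 * j + 12)) v = 3"
  | "vertex_code v = 6 * j + 28"
      "pdist n (A 1) v = j + 5" "pdist n (B 6) v = min (2 * j + 3) (j + 4)" "pdist n (B (2 * j + 12)) v = 3"
  | "vertex_code v = 6 * j + 29"
      "pdist n (A 1) v = j + 6" "pdist n (B 6) v = min (2 * j + 4) (j + 5)" "pdist n (B (2 * j + 12)) v = 4"
  | p q where "p + q + 2 = j" "vertex_code v = 6 * p + 33"
      "pdist n (A 1) v = p + 5" "pdist n (B 6) v = p + 4" "pdist n (B (2 * j + 12)) v = q + 4"
  | p q where "p + q + 2 = j" "vertex_code v = 6 * p + 34"
      "pdist n (A 1) v = p + 6" "pdist n (B 6) v = p + 5" "pdist n (B (2 * j + 12)) v = q + 5"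
  | p q where "p + q + 2 = j" "vertex_code v = 6 * p + 35"
      "pdist n (A 1) v = p + 7" "pdist n (B 6) v = p + 6" "pdist n (B (2 * j + 12)) v = q + 6"
  | "vertex_code v = 6 * j + 36"
      "pdist n (A 1) v = j + 5" "pdist n (B 6) v = j + 4" "pdist n (B (2 * j + 12)) v = 1"
  | "vertex_code v = 6 * j + 37"
      "pdist n (A 1) v = j + 6" "pdist n (B 6) v = j + 5" "pdist n (B (2 * j + 12)) v = 0"
  | "vertex_code v = 6 * j + 38"
      "pdist n (A 1) v = j + 7" "pdist n (B 6) v = j + 6" "pdist n (B (2 * j + 12)) v = 1"
  | "vertex_code v = 6 * j + 39"
      "pdist n (A 1) v = j + 6" "pdist n (B 6) v = j + 5" "pdist n (B (2 * j + 12)) v = 2"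
  | "vertex_code v = 6 * j + 40"
      "pdist n (A 1) v = j + 6" "pdist n (B 6) v = j + 6" "pdist n (B (2 * j + 12)) v = 1"
  | "vertex_code v = 6 * j + 41"
      "pdist n (A 1) v = j + 7" "pdist n (B 6) v = j + 7" "pdist n (B (2 * j + 12)) v = 2"
  | "vertex_code v = 6 * j + 42"
      "pdist n (A 1) v = j + 4" "pdist n (B 6) v = j + 5" "pdist n (B (2 * j + 12)) v = 2"
  | "vertex_code v = 6 * j + 43"
      "pdist n (A 1) v = j + 5" "pdist n (B 6) v = j + 6" "pdist n (B (2 * j + 12)) v = 2"
  | "vertex_code v = 6 * j + 44"
      "pdist n (A 1) v = j + 6" "pdist n (B 6) v = j + 7" "pdist n (B (2 * j + 12)) v = 3"
  | "vertex_code v = 6 * j + 45"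
      "pdist n (A 1) v = j + 6" "pdist n (B 6) v = j + 6" "pdist n (B (2 * j + 12)) v = 3"
  | "vertex_code v = 6 * j + 46"
      "pdist n (A 1) v = j + 5" "pdist n (B 6) v = j + 7" "pdist n (B (2 * j + 12)) v = 3"
  | "vertex_code v = 6 * j + 47"
      "pdist n (A 1) v = j + 6" "pdist n (B 6) v = j + 8" "pdist n (B (2 * j + 12)) v = 4"
  | "vertex_code v = 6 * j + 48"
      "pdist n (A 1) v = j + 3" "pdist n (B 6) v = j + 6" "pdist n (B (2 * j + 12)) v = 3"
  | "vertex_code v = 6 * j + 49"
      "pdist n (A 1) v = j + 4" "pdist n (B 6) v = j + 7" "pdist n (B (2 * j + 12)) v = 4"
  | "vertex_code v = 6 * j + 50"
      "pdist n (A 1) v = j + 5" "pdist n (B 6) v = j + 8" "pdist n (B (2 * j + 12)) v = 5"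
  | p q where "p + q = j + 2" "vertex_code v = 6 * j + 6 * p + 51"
      "pdist n (A 1) v = q + 3" "pdist n (B 6) v = q + 4" "pdist n (B (2 * j + 12)) v = p + 4"
  | p q where "p + q = j + 2" "vertex_code v = 6 * j + 6 * p + 52"
      "pdist n (A 1) v = q + 2" "pdist n (B 6) v = q + 5" "pdist n (B (2 * j + 12)) v = p + 5"
  | p q where "p + q = j + 2" "vertex_code v = 6 * j + 6 * p + 53"
      "pdist n (A 1) v = q + 3" "pdist n (B 6) v = q + 6" "pdist n (B (2 * j + 12)) v = p + 6"
  | p q where "p + q = j + 1" "vertex_code v = 6 * j + 6 * p + 54"
      "pdist n (A 1) v = q + 1" "pdist n (B 6) v = q + 5" "pdist n (B (2 * j + 12)) v = p + 4"
  | p q where "p + q = j + 1" "vertex_code v = 6 * j + 6 * p + 55"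
      "pdist n (A 1) v = q + 2" "pdist n (B 6) v = q + 6" "pdist n (B (2 * j + 12)) v = p + 5"
  | p q where "p + q = j + 1" "vertex_code v = 6 * j + 6 * p + 56"
      "pdist n (A 1) v = q + 3" "pdist n (B 6) v = q + 7" "pdist n (B (2 * j + 12)) v = p + 6"
proof (cases rule: gap_cases_mod_1[OF n index_in[OF v]])
  case 1
  then show thesis using that(1) that(2) that(3)
    by (cases v) (simp_all add: pdist_simps hops_def)
next
  case 2
  then show thesis using that(4) that(5) that(6)
    by (cases v) (simp_all add: pdist_simps hops_def)
next
  case 3
  then show thesis using that(7) that(8) that(9)
    by (cases v) (simp_all add: pdist_simps hops_def)
next
  case 4
  then show thesis using that(10) that(11) that(12)
    by (cases v) (simp_all add: pdist_simps hops_def)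
next
  case 5
  then show thesis using that(13) that(14) that(15)
    by (cases v) (simp_all add: pdist_simps hops_def)
next
  case (6 p q)
  \<comment> \<open>The gaps to the \<open>B\<close>-landmarks are \<open>2 * p\<close> and
    \<open>2 * q + 2\<close>. From gap 4 on the detour through the \<open>A\<close>-layer is no
    longer than the \<open>B\<close>-cycle, so beyond these thresholds every \<open>min\<close> is
    resolved.\<close>
  have "p = 0 \<or> p = 1 \<or> q = 0 \<or> (\<exists>p' q'. p = p' + 2 \<and> q = q' + 1)"
    by presburger
  then show thesis
  proof (elim disjE exE conjE)
    assume "p = 0"
    moreover from this 6(1) have "q = j + 2" by simp
    ultimately show thesis using 6 that(16) that(17) that(18)
      by (cases v) (simp_all add: pdist_simps hops_def)
  next
    assume "p = 1"
    moreover from this 6(1) have "q = j + 1" by simp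
    ultimately show thesis using 6 that(19) that(20) that(21)
      by (cases v) (simp_all add: pdist_simps hops_def)
  next
    assume "q = 0"
    moreover from this 6(1) have "p = j + 2" by simp
    ultimately show thesis using 6 that(22) that(23) that(24)
      by (cases v) (simp_all add: pdist_simps hops_def)
  next
    fix p' q' assume pq: "p = p' + 2" "q = q' + 1"
    with 6 show thesis using that(25)[of p' q'] that(26)[of p' q'] that(27)[of p' q']
      by (cases v) (simp_all add: pdist_simps hops_def)
  qed
next
  case (7 p q)
  \<comment> \<open>Now both gaps are odd, \<open>2 * p + 1\<close> and \<open>2 * q + 1\<close>. At
    gap 3 the \<open>B\<close>-cycle is still shorter, so both thresholds are 2.\<close>
  have "p = 0 \<or> p = 1 \<or> q = 0 \<or> q = 1 \<or> (\<exists>p' q'. p = p' + 2 \<and> q = q' + 2)"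
    by presburger
  then show thesis
  proof (elim disjE exE conjE)
    assume "p = 0"
    moreover from this 7(1) have "q = j + 2" by simp
    ultimately show thesis using 7 that(28) that(29) that(30)
      by (cases v) (simp_all add: pdist_simps hops_def)
  next
    assume "p = 1"
    moreover from this 7(1) have "q = j + 1" by simp
    ultimately show thesis using 7 that(31) that(32) that(33)
      by (cases v) (simp_all add: pdist_simps hops_def)
  next
    assume "q = 0"
    moreover from this 7(1) have "p = j + 2" by simp
    ultimately show thesis using 7 that(34) that(35) that(36)
      by (cases v) (simp_all add: pdist_simps hops_def)
  next
    assume "q = 1"
    moreover from this 7(1) have "p = j + 1" by simp
    ultimately show thesis using 7 that(37) that(38) that(39)
      by (cases v) (simp_all add: pdist_simps hops_def)
  next
    fix p' q' assume pq: "p = p' + 2" "q = q' + 2"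
    with 7 show thesis using that(40)[of p' q'] that(41)[of p' q'] that(42)[of p' q']
      by (cases v) (simp_all add: pdist_simps hops_def)
  qed
next
  case 8
  then show thesis using that(43) that(44) that(45)
    by (cases v) (simp_all add: pdist_simps hops_def)
next
  case 9
  then show thesis using that(46) that(47) that(48)
    by (cases v) (simp_all add: pdist_simps hops_def)
next
  case 10
  then show thesis using that(49) that(50) that(51)
    by (cases v) (simp_all add: pdist_simps hops_def)
next
  case 11
  then show thesis using that(52) that(53) that(54)
    by (cases v) (simp_all add: pdist_simps hops_def)
next
  case 12
  then show thesis using that(55) that(56) that(57)
    by (cases v) (simp_all add: pdist_simps hops_def)
next
  case (13 p q)
  then show thesis using that(58)[of p q] that(59)[of p q] that(60)[of p q]
    by (cases v) (simp_all add: pdist_simps hops_def)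
next
  case (14 p q)
  then show thesis using that(61)[of p q] that(62)[of p q] that(63)[of p q]
    by (cases v) (simp_all add: pdist_simps hops_def)
qed

text \<open>Away from the exceptional rows, the difference of the first two distances and the sum of
  the first and third again separate the twelve classes of layer, parity and arc.\<close>

lemma pdist_inj_mod_1:
  assumes n: "n = 4 * j + 21" and v: "v \<in> pverts (P2_prism n)" and w: "w \<in> pverts (P2_prism n)"
    and eq: "pdist n (A 1) v = pdist n (A 1) w"
    "pdist n (B 6) v = pdist n (B 6) w"
    "pdist n (B (2 * j + 12)) v = pdist n (B (2 * j + 12)) w"
  shows "v = w"
proof -
  have False if "vertex_code x < vertex_code y" "x \<in> pverts (P2_prism n)" "y \<in> pverts (P2_prism n)"
    "pdist n (A 1) x = pdist n (A 1) y" "pdist n (B 6) x = pdist n (B 6) y"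
    "pdist n (B (2 * j + 12)) x = pdist n (B (2 * j + 12)) y" for x y
    using that(1,4-6)
    by - (rule pdist_cases_mod_1[OF n that(2)]; (rule pdist_cases_mod_1[OF n that(3)]; (linarith | simp, presburger)))
  from this[of v w] this[of w v] show ?thesis using assms by (metis vertex_code_inj nat_neq_iff)
qed

lemma pdist_cases_mod_2:
  assumes n: "n = 4 * j + 14" and v: "v \<in> pverts (P2_prism n)"
  obtains
    "vertex_code v = 3"
      "pdist n (A 1) v = 0" "pdist n (A 4) v = 4" "pdist n (A (2 * j + 7)) v = j + 3"
  | "vertex_code v = 4"
      "pdist n (A 1) v = 1" "pdist n (A 4) v = 3" "pdist n (A (2 * j + 7)) v = j + 4"
  | "vertex_code v = 5"
      "pdist n (A 1) v = 2" "pdist n (A 4) v = 4" "pdist n (A (2 * j + 7)) v = j + 5"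
  | "vertex_code v = 6"
      "pdist n (A 1) v = 3" "pdist n (A 4) v = 1" "pdist n (A (2 * j + 7)) v = j + 5"
  | "vertex_code v = 7"
      "pdist n (A 1) v = 2" "pdist n (A 4) v = 2" "pdist n (A (2 * j + 7)) v = j + 4"
  | "vertex_code v = 8"
      "pdist n (A 1) v = 3" "pdist n (A 4) v = 3" "pdist n (A (2 * j + 7)) v = j + 5"
  | "vertex_code v = 9"
      "pdist n (A 1) v = 1" "pdist n (A 4) v = 3" "pdist n (A (2 * j + 7)) v = j + 2"
  | "vertex_code v = 10"
      "pdist n (A 1) v = 2" "pdist n (A 4) v = 2" "pdist n (A (2 * j + 7)) v = j + 3"
  | "vertex_code v = 11"
      "pdist n (A 1) v = 3" "pdist n (A 4) v = 3" "pdist n (A (2 * j + 7)) v = j + 4"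
  | p q where "p + q = j + 1" "vertex_code v = 6 * p + 15"
      "pdist n (A 1) v = p + 2" "pdist n (A 4) v = p + 3" "pdist n (A (2 * j + 7)) v = q"
  | p q where "p + q = j + 1" "vertex_code v = 6 * p + 16"
      "pdist n (A 1) v = p + 3" "pdist n (A 4) v = p + 2" "pdist n (A (2 * j + 7)) v = q + 1"
  | p q where "p + q = j + 1" "vertex_code v = 6 * p + 17"
      "pdist n (A 1) v = p + 4" "pdist n (A 4) v = p + 3" "pdist n (A (2 * j + 7)) v = q + 2"
  | p q where "p + q = j + 1" "vertex_code v = 6 * p + 12"
      "pdist n (A 1) v = p + 4" "pdist n (A 4) v = p" "pdist n (A (2 * j + 7)) v = q + 3"
  | p q where "p + q = j + 1" "vertex_code v = 6 * p + 13"
      "pdist n (A 1) v = p + 3" "pdist n (A 4) v = p + 1" "pdist n (A (2 * j + 7)) v = q + 2"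
  | p q where "p + q = j + 1" "vertex_code v = 6 * p + 14"
      "pdist n (A 1) v = p + 4" "pdist n (A 4) v = p + 2" "pdist n (A (2 * j + 7)) v = q + 3"
  | "vertex_code v = 6 * j + 24"
      "pdist n (A 1) v = j + 6" "pdist n (A 4) v = j + 2" "pdist n (A (2 * j + 7)) v = 3"
  | "vertex_code v = 6 * j + 25"
      "pdist n (A 1) v = j + 5" "pdist n (A 4) v = j + 3" "pdist n (A (2 * j + 7)) v = 2"
  | "vertex_code v = 6 * j + 26"
      "pdist n (A 1) v = j + 6" "pdist n (A 4) v = j + 4" "pdist n (A (2 * j + 7)) v = 3"
  | "vertex_code v = 6 * j + 27"
      "pdist n (A 1) v = j + 3" "pdist n (A 4) v = j + 5" "pdist n (A (2 * j + 7)) v = 1"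
  | "vertex_code v = 6 * j + 28"
      "pdist n (A 1) v = j + 4" "pdist n (A 4) v = j + 4" "pdist n (A (2 * j + 7)) v = 2"
  | "vertex_code v = 6 * j + 29"
      "pdist n (A 1) v = j + 5" "pdist n (A 4) v = j + 5" "pdist n (A (2 * j + 7)) v = 3"
  | "vertex_code v = 6 * j + 30"
      "pdist n (A 1) v = j + 5" "pdist n (A 4) v = j + 3" "pdist n (A (2 * j + 7)) v = 4"
  | "vertex_code v = 6 * j + 31"
      "pdist n (A 1) v = j + 4" "pdist n (A 4) v = j + 4" "pdist n (A (2 * j + 7)) v = 3"
  | "vertex_code v = 6 * j + 32"
      "pdist n (A 1) v = j + 5" "pdist n (A 4) v = j + 5" "pdist n (A (2 * j + 7)) v = 4"
  | p q where "p + q = j + 1" "vertex_code v = 6 * j + 6 * p + 36"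
      "pdist n (A 1) v = q + 3" "pdist n (A 4) v = q + 2" "pdist n (A (2 * j + 7)) v = p + 5"
  | p q where "p + q = j + 1" "vertex_code v = 6 * j + 6 * p + 37"
      "pdist n (A 1) v = q + 2" "pdist n (A 4) v = q + 3" "pdist n (A (2 * j + 7)) v = p + 4"
  | p q where "p + q = j + 1" "vertex_code v = 6 * j + 6 * p + 38"
      "pdist n (A 1) v = q + 3" "pdist n (A 4) v = q + 4" "pdist n (A (2 * j + 7)) v = p + 5"
  | p q where "p + q = j + 1" "vertex_code v = 6 * j + 6 * p + 33"
      "pdist n (A 1) v = q + 1" "pdist n (A 4) v = q + 5" "pdist n (A (2 * j + 7)) v = p + 2"
  | p q where "p + q = j + 1" "vertex_code v = 6 * j + 6 * p + 34"
      "pdist n (A 1) v = q + 2" "pdist n (A 4) v = q + 4" "pdist n (A (2 * j + 7)) v = p + 3"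
  | p q where "p + q = j + 1" "vertex_code v = 6 * j + 6 * p + 35"
      "pdist n (A 1) v = q + 3" "pdist n (A 4) v = q + 5" "pdist n (A (2 * j + 7)) v = p + 4"
proof (cases rule: gap_cases_mod_2[OF n index_in[OF v]])
  case 1
  then show thesis using that(1) that(2) that(3)
    by (cases v) (simp_all add: pdist_simps hops_def)
next
  case 2
  then show thesis using that(4) that(5) that(6)
    by (cases v) (simp_all add: pdist_simps hops_def)
next
  case 3
  then show thesis using that(7) that(8) that(9)
    by (cases v) (simp_all add: pdist_simps hops_def)
next
  case (4 p q)
  then show thesis using that(10)[of p q] that(11)[of p q] that(12)[of p q]
    by (cases v) (simp_all add: pdist_simps hops_def)
next
  case (5 p q)
  then show thesis using that(13)[of p q] that(14)[of p q] that(15)[of p q]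
    by (cases v) (simp_all add: pdist_simps hops_def)
next
  case 6
  then show thesis using that(16) that(17) that(18)
    by (cases v) (simp_all add: pdist_simps hops_def)
next
  case 7
  then show thesis using that(19) that(20) that(21)
    by (cases v) (simp_all add: pdist_simps hops_def)
next
  case 8
  then show thesis using that(22) that(23) that(24)
    by (cases v) (simp_all add: pdist_simps hops_def)
next
  case (9 p q)
  then show thesis using that(25)[of p q] that(26)[of p q] that(27)[of p q]
    by (cases v) (simp_all add: pdist_simps hops_def)
next
  case (10 p q)
  then show thesis using that(28)[of p q] that(29)[of p q] that(30)[of p q]
    by (cases v) (simp_all add: pdist_simps hops_def)
qed

text \<open>Difference and sum of distances separate the twelve classes on the long arcs as for
  \<open>n = 4 * j + 8\<close>; the six singly listed indices add finitely many comparisons.\<close>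

lemma pdist_inj_mod_2:
  assumes n: "n = 4 * j + 14" and v: "v \<in> pverts (P2_prism n)" and w: "w \<in> pverts (P2_prism n)"
    and eq: "pdist n (A 1) v = pdist n (A 1) w"
    "pdist n (A 4) v = pdist n (A 4) w"
    "pdist n (A (2 * j + 7)) v = pdist n (A (2 * j + 7)) w"
  shows "v = w"
proof -
  have False if "vertex_code x < vertex_code y" "x \<in> pverts (P2_prism n)" "y \<in> pverts (P2_prism n)"
    "pdist n (A 1) x = pdist n (A 1) y" "pdist n (A 4) x = pdist n (A 4) y"
    "pdist n (A (2 * j + 7)) x = pdist n (A (2 * j + 7)) y" for x y
    using that(1,4-6)
    by - (rule pdist_cases_mod_2[OF n that(2)]; (rule pdist_cases_mod_2[OF n that(3)]; (linarith | simp, presburger)))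
  from this[of v w] this[of w v] show ?thesis using assms by (metis vertex_code_inj nat_neq_iff)
qed

lemma pdist_cases_mod_3:
  assumes n: "n = 4 * j + 7" and v: "v \<in> pverts (P2_prism n)"
  obtains
    "vertex_code v = 3"
      "pdist n (A 1) v = 0" "pdist n (A 2) v = 3" "pdist n (B (2 * j + 4)) v = j + 3"
  | "vertex_code v = 4"
      "pdist n (A 1) v = 1" "pdist n (A 2) v = 2" "pdist n (B (2 * j + 4)) v = min (2 * j + 3) (j + 4)"
  | "vertex_code v = 5"
      "pdist n (A 1) v = 2" "pdist n (A 2) v = 3" "pdist n (B (2 * j + 4)) v = min (2 * j + 4) (j + 5)"
  | p q where "p + q = j" "vertex_code v = 6 * p + 9"
      "pdist n (A 1) v = p + 1" "pdist n (A 2) v = p + 3" "pdist n (B (2 * j + 4)) v = q + 2"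
  | p q where "p + q = j" "vertex_code v = 6 * p + 10"
      "pdist n (A 1) v = p + 2" "pdist n (A 2) v = p + 2" "pdist n (B (2 * j + 4)) v = min (2 * q + 1) (q + 3)"
  | p q where "p + q = j" "vertex_code v = 6 * p + 11"
      "pdist n (A 1) v = p + 3" "pdist n (A 2) v = p + 3" "pdist n (B (2 * j + 4)) v = min (2 * q + 2) (q + 4)"
  | p q where "p + q = j + 1" "vertex_code v = 6 * p + 6"
      "pdist n (A 1) v = min (p + 3) (p + 2 * q + 1)" "pdist n (A 2) v = p" "pdist n (B (2 * j + 4)) v = q + 1"
  | p q where "p + q = j + 1" "vertex_code v = 6 * p + 7"
      "pdist n (A 1) v = p + 2" "pdist n (A 2) v = p + 1" "pdist n (B (2 * j + 4)) v = min (2 * q) (q + 2)"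
  | p q where "p + q = j + 1" "vertex_code v = 6 * p + 8"
      "pdist n (A 1) v = p + 3" "pdist n (A 2) v = p + 2" "pdist n (B (2 * j + 4)) v = min (2 * q + 1) (q + 3)"
  | "vertex_code v = 6 * j + 15"
      "pdist n (A 1) v = j + 2" "pdist n (A 2) v = j + 2" "pdist n (B (2 * j + 4)) v = 2"
  | "vertex_code v = 6 * j + 16"
      "pdist n (A 1) v = j + 3" "pdist n (A 2) v = j + 3" "pdist n (B (2 * j + 4)) v = 1"
  | "vertex_code v = 6 * j + 17"
      "pdist n (A 1) v = j + 4" "pdist n (A 2) v = j + 4" "pdist n (B (2 * j + 4)) v = 2"
  | p q where "p + q = j" "vertex_code v = 6 * j + 6 * p + 21"
      "pdist n (A 1) v = q + 3" "pdist n (A 2) v = q + 1" "pdist n (B (2 * j + 4)) v = p + 3"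
  | p q where "p + q = j" "vertex_code v = 6 * j + 6 * p + 22"
      "pdist n (A 1) v = q + 2" "pdist n (A 2) v = q + 2" "pdist n (B (2 * j + 4)) v = min (2 * p + 3) (p + 4)"
  | p q where "p + q = j" "vertex_code v = 6 * j + 6 * p + 23"
      "pdist n (A 1) v = q + 3" "pdist n (A 2) v = q + 3" "pdist n (B (2 * j + 4)) v = min (2 * p + 4) (p + 5)"
  | p q where "p + q = j" "vertex_code v = 6 * j + 6 * p + 18"
      "pdist n (A 1) v = q + 1" "pdist n (A 2) v = min (q + 4) (2 * p + q + 2)" "pdist n (B (2 * j + 4)) v = p + 2"
  | p q where "p + q = j" "vertex_code v = 6 * j + 6 * p + 19"
      "pdist n (A 1) v = q + 2" "pdist n (A 2) v = q + 3" "pdist n (B (2 * j + 4)) v = min (2 * p + 2) (p + 3)"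
  | p q where "p + q = j" "vertex_code v = 6 * j + 6 * p + 20"
      "pdist n (A 1) v = q + 3" "pdist n (A 2) v = q + 4" "pdist n (B (2 * j + 4)) v = min (2 * p + 3) (p + 4)"
proof (cases rule: gap_cases_mod_3[OF n index_in[OF v]])
  case 1
  then show thesis using that(1) that(2) that(3)
    by (cases v) (simp_all add: pdist_simps hops_def)
next
  case (2 p q)
  then show thesis using that(4)[of p q] that(5)[of p q] that(6)[of p q]
    by (cases v) (simp_all add: pdist_simps hops_def)
next
  case (3 p q)
  then show thesis using that(7)[of p q] that(8)[of p q] that(9)[of p q]
    by (cases v) (simp_all add: pdist_simps hops_def)
next
  case 4
  then show thesis using that(10) that(11) that(12)
    by (cases v) (simp_all add: pdist_simps hops_def)
next
  case (5 p q)
  then show thesis using that(13)[of p q] that(14)[of p q] that(15)[of p q]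
    by (cases v) (simp_all add: pdist_simps hops_def)
next
  case (6 p q)
  then show thesis using that(16)[of p q] that(17)[of p q] that(18)[of p q]
    by (cases v) (simp_all add: pdist_simps hops_def)
qed

text \<open>The same separation by difference and sum, disturbed only where a \<open>min\<close>
  switches to its other argument; the comparison of rows includes these switches.\<close>

lemma pdist_inj_mod_3:
  assumes n: "n = 4 * j + 7" and v: "v \<in> pverts (P2_prism n)" and w: "w \<in> pverts (P2_prism n)"
    and eq: "pdist n (A 1) v = pdist n (A 1) w"
    "pdist n (A 2) v = pdist n (A 2) w"
    "pdist n (B (2 * j + 4)) v = pdist n (B (2 * j + 4)) w"
  shows "v = w"
proof -
  have False if "vertex_code x < vertex_code y" "x \<in> pverts (P2_prism n)" "y \<in> pverts (P2_prism n)"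
    "pdist n (A 1) x = pdist n (A 1) y" "pdist n (A 2) x = pdist n (A 2) y"
    "pdist n (B (2 * j + 4)) x = pdist n (B (2 * j + 4)) y" for x y
    using that(1,4-6)
    by - (rule pdist_cases_mod_3[OF n that(2)]; (rule pdist_cases_mod_3[OF n that(3)]; (linarith | simp, presburger)))
  from this[of v w] this[of w v] show ?thesis using assms by (metis vertex_code_inj nat_neq_iff)
qed

text \<open>The six orders below the starting points of the families get landmarks of their own. For
  \<open>n = 9\<close>, say, the second and third landmark of the family, \<open>B 6\<close> and
  \<open>B ((n + 3) / 2)\<close>, would coincide, and for \<open>n = 5\<close> there is no
  \<open>B 6\<close>.\<close>

lemma resolved_17: "distinct (map (\<lambda>v. (pdist 17 (A 1) v, pdist 17 (B 3) v, pdist 17 (B 8) v)) (prism_list 17))"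
  by code_simp
lemma resolved_5: "distinct (map (\<lambda>v. (pdist 5 (A 1) v, pdist 5 (B 2) v, pdist 5 (B 4) v)) (prism_list 5))"
  by code_simp
lemma resolved_6: "distinct (map (\<lambda>v. (pdist 6 (A 1) v, pdist 6 (A 2) v, pdist 6 (A 3) v)) (prism_list 6))"
  by code_simp
lemma resolved_9: "distinct (map (\<lambda>v. (pdist 9 (A 1) v, pdist 9 (B 3) v, pdist 9 (B 5) v)) (prism_list 9))"
  by code_simp
lemma resolved_10: "distinct (map (\<lambda>v. (pdist 10 (A 1) v, pdist 10 (A 4) v, pdist 10 (A 7) v)) (prism_list 10))"
  by code_simp
lemma resolved_13: "distinct (map (\<lambda>v. (pdist 13 (A 1) v, pdist 13 (B 2) v, pdist 13 (B 7) v)) (prism_list 13))"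
  by code_simp

lemma resolving_set_of_card_3I:
  assumes n: "n \<ge> 5"
    and in_verts: "a \<in> pverts (P2_prism n)" "b \<in> pverts (P2_prism n)" "c \<in> pverts (P2_prism n)"
    and distinct: "a \<noteq> b" "a \<noteq> c" "b \<noteq> c"
    and inj: "\<And>v w. v \<in> pverts (P2_prism n) \<Longrightarrow> w \<in> pverts (P2_prism n) \<Longrightarrow>
      pdist n a v = pdist n a w \<Longrightarrow> pdist n b v = pdist n b w \<Longrightarrow> pdist n c v = pdist n c w \<Longrightarrow> v = w"
  shows "\<exists>U. resolving_set (P2_prism n) U \<and> finite U \<and> card U = 3"
proof (intro exI conjI)
  have sub: "{a, b, c} \<subseteq> pverts (P2_prism n)" using in_verts by simp
  show "resolving_set (P2_prism n) {a, b, c}"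
    unfolding resolving_set_P2_prism_iff[OF n sub] using inj by simp
qed (use distinct in simp_all)

lemma pdist_inj_of_distinct:
  assumes "distinct (map (\<lambda>v. (pdist n a v, pdist n b v, pdist n c v)) (prism_list n))"
    and "v \<in> pverts (P2_prism n)" "w \<in> pverts (P2_prism n)"
    and "pdist n a v = pdist n a w" "pdist n b v = pdist n b w" "pdist n c v = pdist n c w"
  shows "v = w"
  using assms unfolding distinct_map set_prism_list inj_on_def by blast

lemma ex_resolving_set_of_card_3:
  assumes n: "n \<ge> 5"
  shows "\<exists>U. resolving_set (P2_prism n) U \<and> finite U \<and> card U = 3"
proof -
  \<comment> \<open>By residues modulo 4, the families start at 8, 21, 14 and 7; below them remain
    5, 9, 13, 17 with residue 1 and 6, 10 with residue 2.\<close>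
  consider "n = 5" | "n = 6" | "n = 9" | "n = 10" | "n = 13" | "n = 17"
    | j where "n = 4 * j + 8" | j where "n = 4 * j + 21" | j where "n = 4 * j + 14"
    | j where "n = 4 * j + 7"
  proof -
    have "n = 5 \<or> n = 6 \<or> n = 9 \<or> n = 10 \<or> n = 13 \<or> n = 17 \<or>
      (\<exists>j. n = 4 * j + 8) \<or> (\<exists>j. n = 4 * j + 21) \<or> (\<exists>j. n = 4 * j + 14) \<or> (\<exists>j. n = 4 * j + 7)"
      using n by presburger
    then show thesis using that by blast
  qed
  then show ?thesis
  proof cases
    case 1
    show ?thesis
      by (rule resolving_set_of_card_3I[OF n _ _ _ _ _ _ pdist_inj_of_distinct[OF resolved_5[folded 1]]])
        (simp_all add: 1)
  next
    case 2
    show ?thesis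
      by (rule resolving_set_of_card_3I[OF n _ _ _ _ _ _ pdist_inj_of_distinct[OF resolved_6[folded 2]]])
        (simp_all add: 2)
  next
    case 3
    show ?thesis
      by (rule resolving_set_of_card_3I[OF n _ _ _ _ _ _ pdist_inj_of_distinct[OF resolved_9[folded 3]]])
        (simp_all add: 3)
  next
    case 4
    show ?thesis
      by (rule resolving_set_of_card_3I[OF n _ _ _ _ _ _ pdist_inj_of_distinct[OF resolved_10[folded 4]]])
        (simp_all add: 4)
  next
    case 5
    show ?thesis
      by (rule resolving_set_of_card_3I[OF n _ _ _ _ _ _ pdist_inj_of_distinct[OF resolved_13[folded 5]]])
        (simp_all add: 5)
  next
    case 6
    show ?thesis
      by (rule resolving_set_of_card_3I[OF n _ _ _ _ _ _ pdist_inj_of_distinct[OF resolved_17[folded 6]]])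
        (simp_all add: 6)
  next
    case (7 j)
    show ?thesis
      by (rule resolving_set_of_card_3I[OF n _ _ _ _ _ _ pdist_inj_mod_0[OF 7]]) (simp_all add: 7)
  next
    case (8 j)
    show ?thesis
      by (rule resolving_set_of_card_3I[OF n _ _ _ _ _ _ pdist_inj_mod_1[OF 8]]) (simp_all add: 8)
  next
    case (9 j)
    show ?thesis
      by (rule resolving_set_of_card_3I[OF n _ _ _ _ _ _ pdist_inj_mod_2[OF 9]]) (simp_all add: 9)
  next
    case (10 j)
    show ?thesis
      by (rule resolving_set_of_card_3I[OF n _ _ _ _ _ _ pdist_inj_mod_3[OF 10]]) (simp_all add: 10)
  qed
qed

theorem theorem1:
  fixes n :: nat
  assumes "n \<ge> 5"
  shows "metric_dim (P2_prism n) = 3"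
  unfolding metric_dim_def
proof (rule Least_equality)
  show "\<exists>U. resolving_set (P2_prism n) U \<and> finite U \<and> card U = 3"
    using assms by (rule ex_resolving_set_of_card_3)
  show "3 \<le> k" if "\<exists>U. resolving_set (P2_prism n) U \<and> finite U \<and> card U = k" for k
    using that card_resolving_set_ge_3[OF assms] by blast
qed

end
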